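(* Let $k$ be a field and $Q$ a finite acyclic quiver with vertex set $Q_0$. The radical $\mathrm{rad}(\mathcal{B}_Q)$ of $\mathcal{B}_Q$ is the $k$-linear span of the set $\{X_{\{w\}}-X_w\mid w \text{ a word over } Q_0\}$. So $\mathcal{B}_Q$ is a basic algebra, and $(E_M)_{M\subseteq Q_0}$ is a system of representatives of its simple modules.
   Context: $\mathcal{B}_Q$ is the unital associative $k$-algebra with generators $X_t$ ($t\in Q_0$) and relations $X_s^2=X_s$ for all $s$; $X_sX_tX_s=X_tX_sX_t$ for all $s,t$; $X_tX_sX_t=X_sX_t$ whenever there is no arrow from $t$ to $s$ in $Q$. For a word $w=w_1\cdots w_m$ over $Q_0$, $X_w=X_{w_1}\cdots X_{w_m}$ ($X_\emptyset=1$), and $\{w\}\subseteq Q_0$ is the set of letters occurring in $w$. For $M\subseteq Q_0$ let $Q_M$ be the full subquiver on $M$. Define $\mathrm{S}_0M$ to be the set of $q\in M$ that are sinks in $Q_M$, and inductively $\mathrm{S}_{j+1}M$ to be the set of sinks of $Q_{M\setminus(\mathrm{S}_0M\cup\dots\cup \mathrm{S}_jM)}$. Let $m$ be the index with $\mathrm{S}_mM\neq\emptyset=\mathrm{S}_{m+1}M$ (for $M\neq\emptyset$). Since there are no arrows inside $Q_{\mathrm{S}_jM}$, the $X_q$ with $q\in\mathrm{S}_jM$ commute, and one defines $X_M=\prod_{q\in\mathrm{S}_mM}X_q\ \cdots\ \prod_{q\in\mathrm{S}_1M}X_q\prod_{q\in\mathrm{S}_0M}X_q$, with $X_\emptyset=1$.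 The notation $X_{\{w\}}$ means $X_M$ for $M=\{w\}$. $E_M$ is the one-dimensional left $\mathcal{B}_Q$-module $k$ on which $X_q$ acts as $1$ if $q\in M$ and as $0$ if $q\notin M$. *)

theory Defs
  imports
    "HOL-Library.Poly_Mapping"
    "Graph_Theory.Graph_Theory"
    "HOL-Algebra.Algebra"
begin

section \<open>Finite-dimensional algebras and left modules\<close>

text \<open>
  An associative unital \<open>k\<close>-algebra is represented by a ring \<open>A\<close> together with the subset
  \<open>K \<subseteq> carrier A\<close> of its scalars (the image of \<open>k\<close>), following the convention of
  \<^theory>\<open>HOL-Algebra.Embedded_Algebras\<close>; \<^term>\<open>ring.Span A K Us\<close> is the \<open>k\<close>-linear span of a finite list.
\<close>

definition linear_span :: "'a set \<Rightarrow> ('a, 'm) ring_scheme \<Rightarrow> 'a set \<Rightarrow> 'a set" where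
  "linear_span K A S = (\<Union>Us \<in> {Us. set Us \<subseteq> S}. ring.Span A K Us)"

locale left_ideal = additive_subgroup I R + ring R for I and R (structure) +
  assumes I_l_closed: "\<lbrakk>a \<in> I; x \<in> carrier R\<rbrakk> \<Longrightarrow> x \<otimes> a \<in> I"

definition maximal_left_ideal :: "'a set \<Rightarrow> ('a, 'm) ring_scheme \<Rightarrow> bool" where
  "maximal_left_ideal I R \<longleftrightarrow> left_ideal I R \<and> I \<noteq> carrier R \<and>
     (\<forall>J. left_ideal J R \<longrightarrow> I \<subseteq> J \<longrightarrow> J = I \<or> J = carrier R)"

text \<open>The Jacobson radical.\<close>

definition radical :: "('a, 'm) ring_scheme \<Rightarrow> 'a set" where
  "radical R = carrier R \<inter> \<Inter>{I. maximal_left_ideal I R}"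

definition division_ring :: "('a, 'm) ring_scheme \<Rightarrow> bool" where
  "division_ring D \<longleftrightarrow> ring D \<and> Units D = carrier D - {\<zero>\<^bsub>D\<^esub>}"

text \<open>
  A finite-dimensional algebra is basic if it is a finite product of division rings modulo its
  radical. Every factor of such a product embeds into \<open>A Quot radical A\<close>, so requiring the factors
  to have their elements in the type of that quotient is no restriction; a ring isomorphism
  suffices, since it turns the factors into \<open>k\<close>-algebras.
\<close>

definition basic_algebra :: "'a set \<Rightarrow> ('a, 'm) ring_scheme \<Rightarrow> bool" where
  "basic_algebra K A \<longleftrightarrow> ring.finite_dimension A K (carrier A) \<and>
     (\<exists>Ds :: 'a set ring list. (\<forall>D \<in> set Ds. division_ring D) \<and>
        A Quot radical A \<simeq> RDirProd_list Ds)"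

text \<open>The locale \<^locale>\<open>module\<close> of the library requires the ring to be commutative.\<close>

locale left_module = R?: ring R + M?: abelian_group M
    for R :: "('a, 'm) ring_scheme" (structure) and M :: "('a, 'b, 'n) module_scheme" (structure) +
  assumes smult_closed:
      "\<lbrakk>a \<in> carrier R; x \<in> carrier M\<rbrakk> \<Longrightarrow> a \<odot>\<^bsub>M\<^esub> x \<in> carrier M"
    and smult_l_distr:
      "\<lbrakk>a \<in> carrier R; b \<in> carrier R; x \<in> carrier M\<rbrakk> \<Longrightarrow>
        (a \<oplus> b) \<odot>\<^bsub>M\<^esub> x = a \<odot>\<^bsub>M\<^esub> x \<oplus>\<^bsub>M\<^esub> b \<odot>\<^bsub>M\<^esub> x"
    and smult_r_distr:
      "\<lbrakk>a \<in> carrier R; x \<in> carrier M; y \<in> carrier M\<rbrakk> \<Longrightarrow>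
        a \<odot>\<^bsub>M\<^esub> (x \<oplus>\<^bsub>M\<^esub> y) = a \<odot>\<^bsub>M\<^esub> x \<oplus>\<^bsub>M\<^esub> a \<odot>\<^bsub>M\<^esub> y"
    and smult_assoc:
      "\<lbrakk>a \<in> carrier R; b \<in> carrier R; x \<in> carrier M\<rbrakk> \<Longrightarrow>
        (a \<otimes> b) \<odot>\<^bsub>M\<^esub> x = a \<odot>\<^bsub>M\<^esub> (b \<odot>\<^bsub>M\<^esub> x)"
    and smult_one:
      "x \<in> carrier M \<Longrightarrow> \<one> \<odot>\<^bsub>M\<^esub> x = x"

definition simple_left_module ::
    "('a, 'm) ring_scheme \<Rightarrow> ('a, 'b, 'n) module_scheme \<Rightarrow> bool" where
  "simple_left_module R M \<longleftrightarrow> left_module R M \<and> carrier M \<noteq> {\<zero>\<^bsub>M\<^esub>} \<and>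
     (\<forall>H. submodule H R M \<longrightarrow> H = {\<zero>\<^bsub>M\<^esub>} \<or> H = carrier M)"

definition isomorphic_modules ::
    "('a, 'm) ring_scheme \<Rightarrow> ('a, 'b, 'n) module_scheme \<Rightarrow> ('a, 'c, 'p) module_scheme \<Rightarrow> bool" where
  "isomorphic_modules R M N \<longleftrightarrow>
     (\<exists>h. bij_betw h (carrier M) (carrier N) \<and>
        (\<forall>x \<in> carrier M. \<forall>y \<in> carrier M. h (x \<oplus>\<^bsub>M\<^esub> y) = h x \<oplus>\<^bsub>N\<^esub> h y) \<and>
        (\<forall>a \<in> carrier R. \<forall>x \<in> carrier M. h (a \<odot>\<^bsub>M\<^esub> x) = a \<odot>\<^bsub>N\<^esub> h x))"


section \<open>Quivers\<close>

text \<open>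
  A quiver is a \<^typ>\<open>('v, 'e) pre_digraph\<close> satisfying \<^locale>\<open>wf_digraph\<close>: parallel arrows and
  (a priori) loops are allowed. In \<^const>\<open>pre_digraph.cycle\<close>, a loop is a cycle.
\<close>

definition acyclic_quiver :: "('v, 'e) pre_digraph \<Rightarrow> bool" where
  "acyclic_quiver Q \<longleftrightarrow> (\<nexists>p. pre_digraph.cycle Q p)"

definition sinks :: "('v, 'e) pre_digraph \<Rightarrow> 'v set" where
  "sinks Q = {q \<in> verts Q. out_arcs Q q = {}}"

text \<open>\<open>sink_layer Q M j\<close> is \<open>S\<^sub>j M\<close>; for \<open>j = 0\<close> nothing is removed from \<open>M\<close>.\<close>

fun sink_layer :: "('v, 'e) pre_digraph \<Rightarrow> 'v set \<Rightarrow> nat \<Rightarrow> 'v set" where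
  "sink_layer Q M j = sinks (induce_subgraph Q (M - \<Union>(set (map (sink_layer Q M) [0..<j]))))"

declare sink_layer.simps [simp del]


section \<open>The algebra \<open>\<B>\<^sub>Q\<close>\<close>

text \<open>
  Words form a monoid under concatenation. As the convolution product of
  \<^theory>\<open>HOL-Library.Poly_Mapping\<close> expects it, the monoid is written additively, and
  \<^typ>\<open>'v list \<Rightarrow>\<^sub>0 'k\<close> is the free associative algebra on \<^typ>\<open>'v\<close>.
\<close>

instantiation list :: (type) monoid_add
begin

definition zero_list :: "'a list" where "zero_list = []"

definition plus_list :: "'a list \<Rightarrow> 'a list \<Rightarrow> 'a list" where "plus_list = (@)"

instance by standard (simp_all add: zero_list_def plus_list_def)

end

definition free_algebra :: "'v set \<Rightarrow> ('v list \<Rightarrow>\<^sub>0 'k::field) ring" where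
  "free_algebra V = \<lparr>carrier = {f. Poly_Mapping.keys f \<subseteq> lists V}, mult = (*), one = 1, ring.zero = 0, add = (+)\<rparr>"

abbreviation word_poly :: "'v list \<Rightarrow> 'v list \<Rightarrow>\<^sub>0 'k::field" where
  "word_poly w \<equiv> Poly_Mapping.single w 1"

definition BQ_relations :: "('v, 'e) pre_digraph \<Rightarrow> ('v list \<Rightarrow>\<^sub>0 'k::field) set" where
  "BQ_relations Q =
     {word_poly [s, s] - word_poly [s] | s. s \<in> verts Q} \<union>
     {word_poly [s, t, s] - word_poly [t, s, t] | s t. s \<in> verts Q \<and> t \<in> verts Q} \<union>
     {word_poly [t, s, t] - word_poly [s, t] | s t. s \<in> verts Q \<and> t \<in> verts Q \<and> \<not> t \<rightarrow>\<^bsub>Q\<^esub> s}"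

definition BQ_ideal :: "('v, 'e) pre_digraph \<Rightarrow> ('v list \<Rightarrow>\<^sub>0 'k::field) set" where
  "BQ_ideal Q = Idl\<^bsub>free_algebra (verts Q)\<^esub> (BQ_relations Q)"

definition BQ :: "('v, 'e) pre_digraph \<Rightarrow> ('v list \<Rightarrow>\<^sub>0 'k::field) set ring" where
  "BQ Q = free_algebra (verts Q) Quot BQ_ideal Q"

definition BQ_class ::
    "('v, 'e) pre_digraph \<Rightarrow> ('v list \<Rightarrow>\<^sub>0 'k::field) \<Rightarrow> ('v list \<Rightarrow>\<^sub>0 'k) set" where
  "BQ_class Q f = BQ_ideal Q +>\<^bsub>free_algebra (verts Q)\<^esub> f"

definition BQ_scalars :: "('v, 'e) pre_digraph \<Rightarrow> ('v list \<Rightarrow>\<^sub>0 'k::field) set set" where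
  "BQ_scalars Q = range (\<lambda>c. BQ_class Q (Poly_Mapping.single [] c))"

definition X_gen :: "('v, 'e) pre_digraph \<Rightarrow> 'v \<Rightarrow> ('v list \<Rightarrow>\<^sub>0 'k::field) set" where
  "X_gen Q q = BQ_class Q (word_poly [q])"

definition X_word :: "('v, 'e) pre_digraph \<Rightarrow> 'v list \<Rightarrow> ('v list \<Rightarrow>\<^sub>0 'k::field) set" where
  "X_word Q w = foldr (\<otimes>\<^bsub>BQ Q\<^esub>) (map (X_gen Q) w) \<one>\<^bsub>BQ Q\<^esub>"

text \<open>
  \<open>layer_prod Q M m\<close> is \<open>\<Prod>\<^bsub>q \<in> S\<^sub>m M\<^esub> X\<^sub>q \<cdots> \<Prod>\<^bsub>q \<in> S\<^sub>0 M\<^esub> X\<^sub>q\<close>. Although \<open>BQ Q\<close> is not commutative,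
  \<^const>\<open>finprod\<close> is meaningful here, because the \<open>X\<^sub>q\<close> within one layer commute: as a
  \<^const>\<open>foldD\<close> it only needs left commutativity on the index set (locale \<open>LCD\<close>).
\<close>

primrec layer_prod ::
    "('v, 'e) pre_digraph \<Rightarrow> 'v set \<Rightarrow> nat \<Rightarrow> ('v list \<Rightarrow>\<^sub>0 'k::field) set" where
  "layer_prod Q M 0 = finprod (BQ Q) (X_gen Q) (sink_layer Q M 0)"
| "layer_prod Q M (Suc j) =
     finprod (BQ Q) (X_gen Q) (sink_layer Q M (Suc j)) \<otimes>\<^bsub>BQ Q\<^esub> layer_prod Q M j"

definition X_set :: "('v, 'e) pre_digraph \<Rightarrow> 'v set \<Rightarrow> ('v list \<Rightarrow>\<^sub>0 'k::field) set" where
  "X_set Q M = (if M = {} then \<one>\<^bsub>BQ Q\<^esub> else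
     layer_prod Q M (THE m. sink_layer Q M m \<noteq> {} \<and> sink_layer Q M (Suc m) = {}))"


section \<open>The modules \<open>E\<^sub>M\<close>\<close>

text \<open>
  The scalar by which a noncommutative polynomial acts when the letters in \<open>M\<close> act as \<open>1\<close> and
  all other letters as \<open>0\<close>.
\<close>

definition E_eval :: "'v set \<Rightarrow> ('v list \<Rightarrow>\<^sub>0 'k::field) \<Rightarrow> 'k" where
  "E_eval M f = (\<Sum>w \<in> Poly_Mapping.keys f. Poly_Mapping.lookup f w * (\<Prod>q\<leftarrow>w. if q \<in> M then 1 else 0))"

text \<open>
  Elements of \<open>BQ Q\<close> are cosets, on each of which \<^term>\<open>E_eval M\<close> takes a single value. The fields
  \<open>mult\<close> and \<open>one\<close> are present in every \<^typ>\<open>('a, 'b) module\<close> record, but play no role for modules.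
\<close>

definition E_module :: "'v set \<Rightarrow> (('v list \<Rightarrow>\<^sub>0 'k::field) set, 'k) module" where
  "E_module M = \<lparr>carrier = UNIV, mult = (*), one = 1, ring.zero = 0, add = (+),
     smult = (\<lambda>b x. the_elem (E_eval M ` b) * x)\<rparr>"

end

theory Submission
  imports Defs
begin

text \<open>
  The one-dimensional modules \<open>E\<^sub>M\<close> are characters \<open>\<chi>\<^sub>M\<close> of \<open>\<B>\<^sub>Q\<close>, with \<open>\<chi>\<^sub>M(X\<^sub>w) = 1\<close> if
  \<open>{w} \<subseteq> M\<close> and \<open>0\<close> otherwise. If \<open>s\<close> is a sink of the full subquiver on the letters involved,
  then \<open>X\<^sub>s X\<^sub>w X\<^sub>s = X\<^sub>w X\<^sub>s\<close>. Removing sinks one at a time, this shows that only finitely many \<open>X\<^sub>w\<close>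
  are distinct, and that every left module has, modulo each proper submodule, a vector on which
  \<open>\<B>\<^sub>Q\<close> acts through some \<open>\<chi>\<^sub>M\<close>. Hence every simple module is an \<open>E\<^sub>M\<close>, and every maximal left
  ideal contains the common kernel of the \<open>\<chi>\<^sub>M\<close>, which is therefore the radical. An element
  \<open>\<Sum> c\<^sub>w X\<^sub>w\<close> is in that kernel iff \<open>\<Sum> c\<^sub>w\<close> vanishes over the words of each given content
  (induction on the content), which turns it into \<open>\<Sum> (- c\<^sub>w) (X\<^bsub>{w}\<^esub> - X\<^sub>w)\<close>. Products of factors
  \<open>X\<^sub>q\<close> and \<open>1 - X\<^sub>q\<close> separate the characters, so modulo the radical \<open>\<B>\<^sub>Q\<close> is a power of \<open>k\<close>.
\<close>


section \<open>The free algebra\<close>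

lemma poly_mapping_sum_single:
  "(\<Sum>w\<in>Poly_Mapping.keys f. Poly_Mapping.single w (Poly_Mapping.lookup f w)) = f"
proof (rule poly_mapping_eqI)
  fix v
  have "(\<Sum>w\<in>Poly_Mapping.keys f. Poly_Mapping.lookup (Poly_Mapping.single w (Poly_Mapping.lookup f w)) v)
      = (\<Sum>w\<in>Poly_Mapping.keys f. if w = v then Poly_Mapping.lookup f w else 0)"
    by (rule sum.cong) (auto simp: lookup_single)
  then show "Poly_Mapping.lookup (\<Sum>w\<in>Poly_Mapping.keys f. Poly_Mapping.single w (Poly_Mapping.lookup f w)) v
      = Poly_Mapping.lookup f v"
    by (auto simp: lookup_sum sum.delta' in_keys_iff)
qed

text \<open>A finitely supported function is the sum of its monomials. The bound on the support is
  carried through the sum, so that \<open>add\<close> only has to be shown for summands supported in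
  \<open>A\<close>. With words for \<open>A\<close>, this reduces linear statements to single
  words.\<close>

lemma poly_mapping_span_induct [consumes 1, case_names zero single add]:
  fixes f :: "'a \<Rightarrow>\<^sub>0 'b::comm_monoid_add"
  assumes keys: "Poly_Mapping.keys f \<subseteq> A"
    and zero: "P 0"
    and single: "\<And>w c. w \<in> A \<Longrightarrow> P (Poly_Mapping.single w c)"
    and add: "\<And>f g. \<lbrakk>Poly_Mapping.keys f \<subseteq> A; Poly_Mapping.keys g \<subseteq> A; P f; P g\<rbrakk> \<Longrightarrow> P (f + g)"
  shows "P f"
proof -
  have "P (\<Sum>w\<in>W. Poly_Mapping.single w (Poly_Mapping.lookup f w)) \<and>
      Poly_Mapping.keys (\<Sum>w\<in>W. Poly_Mapping.single w (Poly_Mapping.lookup f w)) \<subseteq> A"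
    if "finite W" "W \<subseteq> A" for W
    using that
  proof (induction W)
    case empty
    show ?case using zero by simp
  next
    case (insert w W)
    have "Poly_Mapping.keys (Poly_Mapping.single w (Poly_Mapping.lookup f w)) \<subseteq> A"
      using insert.prems by auto
    then show ?case
      using insert keys_add[of "Poly_Mapping.single w (Poly_Mapping.lookup f w)"
          "\<Sum>w\<in>W. Poly_Mapping.single w (Poly_Mapping.lookup f w)"]
      by (auto intro!: add single)
  qed
  from this[OF finite_keys keys] show ?thesis
    by (simp add: poly_mapping_sum_single)
qed

lemma free_algebra_simps [simp]:
  "f \<in> carrier (free_algebra V) \<longleftrightarrow> Poly_Mapping.keys f \<subseteq> lists V"
  "f \<otimes>\<^bsub>free_algebra V\<^esub> g = f * g"
  "f \<oplus>\<^bsub>free_algebra V\<^esub> g = f + g"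
  "\<zero>\<^bsub>free_algebra V\<^esub> = 0"
  "\<one>\<^bsub>free_algebra V\<^esub> = 1"
  by (simp_all add: free_algebra_def)

lemma keys_mult_subset_lists:
  fixes f g :: "'v list \<Rightarrow>\<^sub>0 'k::field"
  assumes "Poly_Mapping.keys f \<subseteq> lists V" "Poly_Mapping.keys g \<subseteq> lists V"
  shows "Poly_Mapping.keys (f * g) \<subseteq> lists V"
  using keys_mult[of f g] assms by (fastforce simp: plus_list_def)

lemma keys_add_subset:
  fixes f g :: "'a \<Rightarrow>\<^sub>0 'b::comm_monoid_add"
  assumes "Poly_Mapping.keys f \<subseteq> A" "Poly_Mapping.keys g \<subseteq> A"
  shows "Poly_Mapping.keys (f + g) \<subseteq> A"
  using keys_add[of f g] assms by auto

lemma keys_diff_subset: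
  fixes f g :: "'a \<Rightarrow>\<^sub>0 'b::ab_group_add"
  assumes "Poly_Mapping.keys f \<subseteq> A" "Poly_Mapping.keys g \<subseteq> A"
  shows "Poly_Mapping.keys (f - g) \<subseteq> A"
  using keys_add_subset[of f A "- g"] assms by (simp add: keys_minus)

lemma ring_free_algebra: "ring (free_algebra V :: ('v list \<Rightarrow>\<^sub>0 'k::field) ring)"
proof (rule ringI)
  show "abelian_group (free_algebra V :: ('v list \<Rightarrow>\<^sub>0 'k) ring)"
  proof (rule abelian_groupI)
    show "\<exists>y\<in>carrier (free_algebra V). y \<oplus>\<^bsub>free_algebra V\<^esub> x = \<zero>\<^bsub>free_algebra V\<^esub>"
      if "x \<in> carrier (free_algebra V)" for x :: "'v list \<Rightarrow>\<^sub>0 'k"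
      using that by (intro bexI[of _ "- x"]) (simp_all add: keys_minus)
  qed (simp_all add: add.assoc add.commute keys_add_subset)
  show "Group.monoid (free_algebra V :: ('v list \<Rightarrow>\<^sub>0 'k) ring)"
    by (rule monoidI) (simp_all add: mult.assoc keys_mult_subset_lists zero_list_def)
qed (simp_all add: distrib_left distrib_right)

lemma free_algebra_a_inv:
  fixes f :: "'v list \<Rightarrow>\<^sub>0 'k::field"
  assumes "f \<in> carrier (free_algebra V)"
  shows "\<ominus>\<^bsub>free_algebra V\<^esub> f = - f"
proof -
  interpret ring "free_algebra V :: ('v list \<Rightarrow>\<^sub>0 'k) ring" by (rule ring_free_algebra)
  show ?thesis
    by (rule minus_equality) (use assms in \<open>simp_all add: keys_minus\<close>)
qed

section \<open>The characters \<open>E\<^sub>M\<close> of the free algebra\<close>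

text \<open>A product of zeros and ones is 1 only when every factor is. So the character reads off a
  partial sum of coefficients, and of a word it sees only the set of letters.\<close>

lemma E_eval_eq:
  fixes f :: "'v list \<Rightarrow>\<^sub>0 'k::field"
  shows "E_eval M f = (\<Sum>w\<in>Poly_Mapping.keys f. if set w \<subseteq> M then Poly_Mapping.lookup f w else 0)"
proof -
  have "(\<Prod>q\<leftarrow>w. if q \<in> M then 1 else 0) = (if set w \<subseteq> M then 1 else (0::'k))" for w
    by (induction w) auto
  then show ?thesis
    unfolding E_eval_def by (intro sum.cong) auto
qed

text \<open>Words outside the support contribute zero. This gives several polynomials with different
  supports a common index set, as additivity requires.\<close>

lemma E_eval_superset:
  assumes "finite W" "Poly_Mapping.keys f \<subseteq> W"
  shows "E_eval M f = (\<Sum>w\<in>W. if set w \<subseteq> M then Poly_Mapping.lookup f w else 0)"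
  unfolding E_eval_eq by (rule sum.mono_neutral_left) (use assms in \<open>auto simp: in_keys_iff\<close>)

lemma E_eval_single [simp]:
  "E_eval M (Poly_Mapping.single w c) = (if set w \<subseteq> M then c else 0)"
  using E_eval_superset[of "{w}" "Poly_Mapping.single w c" M] by auto

lemma E_eval_0 [simp]: "E_eval M 0 = 0"
  by (simp add: E_eval_eq)

lemma E_eval_1 [simp]: "E_eval M 1 = 1"
  using E_eval_single[of M "[]" 1] by (simp add: zero_list_def [symmetric] del: E_eval_single) (simp add: zero_list_def)

lemma E_eval_add [simp]: "E_eval M (f + g) = E_eval M f + E_eval M g"
proof -
  let ?W = "Poly_Mapping.keys f \<union> Poly_Mapping.keys g"
  have "E_eval M h = (\<Sum>w\<in>?W. if set w \<subseteq> M then Poly_Mapping.lookup h w else 0)"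
    if "h = f \<or> h = g \<or> h = f + g" for h
    by (rule E_eval_superset) (use that keys_add[of f g] in auto)
  then show ?thesis
    by (simp add: sum.distrib [symmetric] lookup_add if_distrib cong: if_cong)
qed

lemma E_eval_minus [simp]: "E_eval M (- f) = - E_eval M f"
  using E_eval_add[of M f "- f"] by (simp add: minus_unique)

lemma E_eval_diff [simp]: "E_eval M (f - g) = E_eval M f - E_eval M g"
  using E_eval_add[of M f "- g"] by simp

text \<open>Both sides are bilinear, so words suffice; there, a concatenation has all its letters in
  \<open>M\<close> exactly when both parts do.\<close>

lemma E_eval_mult [simp]: "E_eval M (f * g) = E_eval M f * E_eval M g"
  using subset_UNIV[of "Poly_Mapping.keys f"]
proof (induction rule: poly_mapping_span_induct)
  case (single v c)
  show ?case
    using subset_UNIV[of "Poly_Mapping.keys g"]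
    by (induction rule: poly_mapping_span_induct)
      (auto simp: mult_single plus_list_def distrib_left)
qed (auto simp: distrib_right)


section \<open>Sinks\<close>

text \<open>A pair in the transitive closure comes from a nonempty walk, and a nonempty closed walk
  contains a cycle.\<close>

lemma acyclic_quiver_imp_acyclic:
  assumes "wf_digraph Q" "acyclic_quiver Q"
  shows "acyclic (arcs_ends Q)"
proof (rule acyclicI, rule allI, rule notI)
  interpret wf_digraph Q by fact
  fix x assume "(x, x) \<in> (arcs_ends Q)\<^sup>+"
  then obtain p where "awalk x p x" "p \<noteq> []"
    using reachable1_awalk by blast
  then have "closed_w p" by (auto simp: closed_w_def)
  then show False
    using closed_w_imp_cycle assms(2) by (auto simp: acyclic_quiver_def)
qed

text \<open>The converse of a finite acyclic relation is well-founded, and an element of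
  \<open>M\<close> minimal for it has no arrow to another element of \<open>M\<close>. All
  inductions over sets of vertices below remove such an element.\<close>

lemma exists_sink:
  assumes "fin_digraph Q" "acyclic_quiver Q" "M \<subseteq> verts Q" "M \<noteq> {}"
  shows "\<exists>s\<in>M. \<forall>t\<in>M. \<not> s \<rightarrow>\<^bsub>Q\<^esub> t"
proof -
  interpret fin_digraph Q by fact
  have fin: "finite ((arcs_ends Q)\<inverse>)"
    using finite_arcs by (simp add: arcs_ends_def)
  have "acyclic ((arcs_ends Q)\<inverse>)"
    using acyclic_quiver_imp_acyclic[OF _ assms(2)] wf_digraph_axioms by simp
  then have "wf ((arcs_ends Q)\<inverse>)"
    by (rule finite_acyclic_wf[OF fin])
  then obtain s where "s \<in> M" "\<And>t. (t, s) \<in> (arcs_ends Q)\<inverse> \<Longrightarrow> t \<notin> M"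
    using assms(4) by (metis ex_in_conv wfE_min)
  then show ?thesis by auto
qed

lemma sinks_induce_subgraph:
  "sinks (induce_subgraph Q M) = {q \<in> M. \<forall>t\<in>M. \<not> q \<rightarrow>\<^bsub>Q\<^esub> t}"
  by (fastforce simp: sinks_def out_arcs_def arcs_ends_def arc_to_ends_def)


section \<open>The algebra \<open>\<B>\<^sub>Q\<close>\<close>

text \<open>The argument \<open>field_type\<close> fixes the coefficient field as a type, so that
  all abbreviations of the locale refer to the same \<open>'k\<close>.\<close>

locale quiver_algebra =
  fixes Q :: "('v, 'e) pre_digraph" and field_type :: "'k::field itself"
  assumes fin_digraph: "fin_digraph Q" and acyclic: "acyclic_quiver Q"
begin

abbreviation V :: "'v set" where "V \<equiv> verts Q"
abbreviation F :: "('v list \<Rightarrow>\<^sub>0 'k) ring" where "F \<equiv> free_algebra V"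
abbreviation B :: "('v list \<Rightarrow>\<^sub>0 'k) set ring" where "B \<equiv> BQ Q"
abbreviation \<pi> :: "('v list \<Rightarrow>\<^sub>0 'k) \<Rightarrow> ('v list \<Rightarrow>\<^sub>0 'k) set" where "\<pi> \<equiv> BQ_class Q"
abbreviation \<xi> :: "'v list \<Rightarrow> ('v list \<Rightarrow>\<^sub>0 'k) set" where "\<xi> \<equiv> X_word Q"
abbreviation scalar :: "'k \<Rightarrow> ('v list \<Rightarrow>\<^sub>0 'k) set"
  where "scalar c \<equiv> \<pi> (Poly_Mapping.single [] c)"
abbreviation \<chi> :: "'v set \<Rightarrow> ('v list \<Rightarrow>\<^sub>0 'k) set \<Rightarrow> 'k"
  where "\<chi> M b \<equiv> the_elem (E_eval M ` b)"

lemma finite_V: "finite V"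
proof -
  interpret fin_digraph Q by (rule fin_digraph)
  show ?thesis by simp
qed

section \<open>The quotient map from the free algebra\<close>

lemma relations_carrier: "BQ_relations Q \<subseteq> carrier F"
  unfolding BQ_relations_def
  by (intro Un_least subsetI; elim CollectE exE conjE)
    (simp_all only: free_algebra_simps, (rule keys_diff_subset; simp)+)

lemma ideal_I: "ideal (BQ_ideal Q) F"
  unfolding BQ_ideal_def by (rule ring.genideal_ideal[OF ring_free_algebra relations_carrier])

lemma \<pi>_eq_rcos: "\<pi> = (+>\<^bsub>F\<^esub>) (BQ_ideal Q)"
  by (rule ext) (simp add: BQ_class_def)

sublocale B: ring B
  unfolding BQ_def by (rule ideal.quotient_is_ring[OF ideal_I])

lemma \<pi>_hom: "ring_hom_ring F B \<pi>"
  unfolding \<pi>_eq_rcos BQ_def by (rule ideal.rcos_ring_hom_ring[OF ideal_I])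

lemma \<pi>_closed [simp]: "Poly_Mapping.keys f \<subseteq> lists V \<Longrightarrow> \<pi> f \<in> carrier B"
  using ring_hom_closed[OF ring_hom_ring.homh[OF \<pi>_hom], of f] by simp

lemma \<pi>_add:
  "\<lbrakk>Poly_Mapping.keys f \<subseteq> lists V; Poly_Mapping.keys g \<subseteq> lists V\<rbrakk> \<Longrightarrow> \<pi> (f + g) = \<pi> f \<oplus>\<^bsub>B\<^esub> \<pi> g"
  using ring_hom_add[OF ring_hom_ring.homh[OF \<pi>_hom], of f g] by simp

lemma \<pi>_mult:
  "\<lbrakk>Poly_Mapping.keys f \<subseteq> lists V; Poly_Mapping.keys g \<subseteq> lists V\<rbrakk> \<Longrightarrow> \<pi> (f * g) = \<pi> f \<otimes>\<^bsub>B\<^esub> \<pi> g"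
  using ring_hom_mult[OF ring_hom_ring.homh[OF \<pi>_hom], of f g] by simp

lemma \<pi>_1: "\<pi> 1 = \<one>\<^bsub>B\<^esub>"
  using ring_hom_one[OF ring_hom_ring.homh[OF \<pi>_hom]] by simp

lemma \<pi>_0 [simp]: "\<pi> 0 = \<zero>\<^bsub>B\<^esub>"
  using ring_hom_zero[OF ring_hom_ring.homh[OF \<pi>_hom] ring_free_algebra B.ring_axioms] by simp

lemma \<pi>_diff:
  assumes "Poly_Mapping.keys f \<subseteq> lists V" "Poly_Mapping.keys g \<subseteq> lists V"
  shows "\<pi> (f - g) = \<pi> f \<ominus>\<^bsub>B\<^esub> \<pi> g"
proof -
  have "\<pi> (f - g) \<oplus>\<^bsub>B\<^esub> \<pi> g = \<pi> f"
    using \<pi>_add[of "f - g" g] assms by (simp add: keys_diff_subset)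
  moreover have "\<pi> f \<in> carrier B" "\<pi> g \<in> carrier B" "\<pi> (f - g) \<in> carrier B"
    using assms by (simp_all add: keys_diff_subset)
  ultimately show ?thesis
    by (metis B.add.inv_closed B.a_assoc B.r_neg B.r_zero a_minus_def)
qed

lemma carrier_B: "carrier B = \<pi> ` {f. Poly_Mapping.keys f \<subseteq> lists V}"
  by (auto simp: BQ_def FactRing_def A_RCOSETS_def' BQ_class_def)

lemma carrier_BE:
  assumes "b \<in> carrier B"
  obtains f where "Poly_Mapping.keys f \<subseteq> lists V" "b = \<pi> f"
  using assms by (auto simp: carrier_B)

text \<open>Turns a defining relation into an equation of \<open>B\<close>: the difference is a
  generator of the ideal and hence maps to zero.\<close>

lemma \<pi>_eqI:
  assumes "Poly_Mapping.keys f \<subseteq> lists V" "Poly_Mapping.keys g \<subseteq> lists V" "f - g \<in> BQ_relations Q"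
  shows "\<pi> f = \<pi> g"
proof -
  have "f - g \<in> BQ_ideal Q"
    unfolding BQ_ideal_def using ring.genideal_self[OF ring_free_algebra relations_carrier] assms(3) by blast
  then have "\<pi> (f - g) = \<zero>\<^bsub>B\<^esub>"
    using ring.a_rcos_zero[OF ring_free_algebra ideal_I]
    by (simp add: BQ_class_def BQ_def FactRing_def)
  then show ?thesis
    using \<pi>_diff[OF assms(1,2)] assms(1,2) B.r_right_minus_eq by simp
qed


subsection \<open>Words and scalars\<close>

lemma X_word_eq: "w \<in> lists V \<Longrightarrow> \<xi> w = \<pi> (word_poly w)"
proof (induction w)
  case Nil
  show ?case
    using \<pi>_1 by (simp add: X_word_def single_one[symmetric] zero_list_def)
next
  case (Cons q w)
  then have "\<xi> (q # w) = \<pi> (word_poly [q]) \<otimes>\<^bsub>B\<^esub> \<pi> (word_poly w)"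
    by (simp add: X_word_def X_gen_def)
  also have "\<dots> = \<pi> (word_poly [q] * word_poly w)"
    using Cons.prems by (intro \<pi>_mult[symmetric]) auto
  finally show ?case by (simp add: mult_single plus_list_def)
qed

lemma X_closed [simp]: "w \<in> lists V \<Longrightarrow> \<xi> w \<in> carrier B"
  by (simp add: X_word_eq)

lemma X_gen_closed [simp]: "q \<in> V \<Longrightarrow> X_gen Q q \<in> carrier B"
  by (simp add: X_gen_def)

lemma X_Nil: "\<xi> [] = \<one>\<^bsub>B\<^esub>"
  by (simp add: X_word_def)

lemma X_Cons: "\<xi> (q # w) = X_gen Q q \<otimes>\<^bsub>B\<^esub> \<xi> w"
  by (simp add: X_word_def)

lemma X_append: "\<lbrakk>u \<in> lists V; v \<in> lists V\<rbrakk> \<Longrightarrow> \<xi> (u @ v) = \<xi> u \<otimes>\<^bsub>B\<^esub> \<xi> v"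
proof (induction u)
  case (Cons q u)
  then show ?case by (simp add: X_Cons B.m_assoc)
qed (simp add: X_Nil)

lemma scalar_closed [simp]: "scalar c \<in> carrier B"
  by simp

lemma scalar_1: "scalar 1 = \<one>\<^bsub>B\<^esub>"
  using X_word_eq[of "[]"] by (simp add: X_Nil)

lemma scalar_add: "scalar (c + d) = scalar c \<oplus>\<^bsub>B\<^esub> scalar d"
  using \<pi>_add[of "Poly_Mapping.single [] c" "Poly_Mapping.single [] d"] by (simp add: single_add)

lemma scalar_mult: "scalar (c * d) = scalar c \<otimes>\<^bsub>B\<^esub> scalar d"
  using \<pi>_mult[of "Poly_Mapping.single [] c" "Poly_Mapping.single [] d"]
  by (simp add: mult_single plus_list_def)

text \<open>The empty word commutes with all words and the coefficients commute in the field, so the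
  scalars are already central in the free algebra.\<close>

lemma scalar_commute:
  assumes "b \<in> carrier B"
  shows "b \<otimes>\<^bsub>B\<^esub> scalar c = scalar c \<otimes>\<^bsub>B\<^esub> b"
proof -
  obtain f where f: "Poly_Mapping.keys f \<subseteq> lists V" "b = \<pi> f"
    using assms by (rule carrier_BE)
  have "f * Poly_Mapping.single [] c = Poly_Mapping.single [] c * f"
    using f(1) by (induction rule: poly_mapping_span_induct)
      (auto simp: mult_single plus_list_def distrib_left distrib_right mult.commute)
  then show ?thesis
    using \<pi>_mult[of f "Poly_Mapping.single [] c"] \<pi>_mult[of "Poly_Mapping.single [] c" f] f by simp
qed

lemma \<pi>_single: "w \<in> lists V \<Longrightarrow> \<pi> (Poly_Mapping.single w c) = scalar c \<otimes>\<^bsub>B\<^esub> \<xi> w"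
  using \<pi>_mult[of "Poly_Mapping.single [] c" "word_poly w"]
  by (simp add: X_word_eq mult_single plus_list_def)

text \<open>The images of monomials span \<open>B\<close>. The zero polynomial needs no case of its
  own, being the scalar 0 times the empty word.\<close>

lemma B_induct [consumes 1, case_names smult add]:
  assumes "b \<in> carrier B"
    and smult: "\<And>w c. w \<in> lists V \<Longrightarrow> P (scalar c \<otimes>\<^bsub>B\<^esub> \<xi> w)"
    and add: "\<And>a b. \<lbrakk>a \<in> carrier B; b \<in> carrier B; P a; P b\<rbrakk> \<Longrightarrow> P (a \<oplus>\<^bsub>B\<^esub> b)"
  shows "P b"
proof -
  obtain f where f: "Poly_Mapping.keys f \<subseteq> lists V" "b = \<pi> f"
    using assms(1) by (rule carrier_BE)
  have "P (\<pi> f)"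
    using f(1)
  proof (induction rule: poly_mapping_span_induct)
    case zero
    show ?case using smult[of "[]" 0] by simp
  next
    case (single w c)
    then show ?case using smult[of w c] \<pi>_single[of w c] by (simp only:)
  next
    case (add f g)
    then show ?case using assms(3) by (simp add: \<pi>_add)
  qed
  then show ?thesis using f(2) by simp
qed


subsection \<open>The characters of \<open>\<B>\<^sub>Q\<close>\<close>

text \<open>In each defining relation the two words have the same set of letters, so the character
  vanishes on the relations. Its kernel is a two-sided ideal and therefore contains the ideal they
  generate.\<close>

lemma E_eval_ideal:
  assumes "f \<in> BQ_ideal Q"
  shows "E_eval M f = (0::'k)"
proof -
  let ?K = "{f \<in> carrier F. E_eval M f = 0}"
  interpret F: ring F by (rule ring_free_algebra)
  have "ideal ?K F"
  proof (rule idealI)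
    show "subgroup ?K (add_monoid F)"
    proof (rule F.add.subgroupI)
      show "?K \<noteq> {}"
        using F.zero_closed E_eval_0 by fastforce
    qed (simp_all add: free_algebra_a_inv keys_minus keys_add_subset subset_iff[of "Collect _"])
  qed (simp_all add: ring_free_algebra keys_mult_subset_lists)
  moreover have "E_eval M r = (0::'k)" if "r \<in> BQ_relations Q" for r
    using that by (auto simp: BQ_relations_def)
  then have "BQ_relations Q \<subseteq> ?K"
    using relations_carrier by blast
  ultimately have "BQ_ideal Q \<subseteq> ?K"
    unfolding BQ_ideal_def by (rule F.genideal_minimal)
  with assms show ?thesis by auto
qed

text \<open>The elements of the coset are \<open>i + f\<close> with \<open>i\<close> in the ideal,
  where the character vanishes. As \<open>f\<close> itself is among them, the image of the coset is
  a singleton and \<open>the_elem\<close> returns its element.\<close>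

lemma \<chi>_\<pi>:
  assumes "Poly_Mapping.keys f \<subseteq> lists V"
  shows "\<chi> M (\<pi> f) = E_eval M f"
proof -
  interpret I: ideal "BQ_ideal Q" F by (rule ideal_I)
  have "f \<in> \<pi> f"
    using I.a_rcos_self[of f] assms by (simp add: BQ_class_def)
  have eq: "E_eval M g = E_eval M f" if "g \<in> \<pi> f" for g
  proof -
    obtain i where "i \<in> BQ_ideal Q" "g = i + f"
      using \<open>g \<in> \<pi> f\<close> by (auto simp: BQ_class_def a_r_coset_def')
    then show ?thesis by (simp add: E_eval_ideal)
  qed
  have "E_eval M ` \<pi> f = (\<lambda>_. E_eval M f) ` \<pi> f"
    by (rule image_cong[OF refl eq])
  also have "\<dots> = {E_eval M f}"
    using \<open>f \<in> \<pi> f\<close> by auto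
  finally have "E_eval M ` \<pi> f = {E_eval M f}" .
  then show ?thesis by simp
qed

lemma \<chi>_scalar [simp]: "\<chi> M (scalar c) = c"
  by (simp add: \<chi>_\<pi>)

lemma \<chi>_one [simp]: "\<chi> M \<one>\<^bsub>B\<^esub> = 1"
  using \<chi>_scalar[of M 1] by (simp only: scalar_1)

lemma \<chi>_zero [simp]: "\<chi> M \<zero>\<^bsub>B\<^esub> = 0"
  using \<chi>_scalar[of M 0] by simp

lemma \<chi>_add [simp]:
  "\<lbrakk>a \<in> carrier B; b \<in> carrier B\<rbrakk> \<Longrightarrow> \<chi> M (a \<oplus>\<^bsub>B\<^esub> b) = \<chi> M a + \<chi> M b"
  by (elim carrier_BE) (simp add: \<chi>_\<pi> keys_add_subset flip: \<pi>_add)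

lemma \<chi>_mult [simp]:
  "\<lbrakk>a \<in> carrier B; b \<in> carrier B\<rbrakk> \<Longrightarrow> \<chi> M (a \<otimes>\<^bsub>B\<^esub> b) = \<chi> M a * \<chi> M b"
  by (elim carrier_BE) (simp add: \<chi>_\<pi> keys_mult_subset_lists flip: \<pi>_mult)

lemma \<chi>_diff [simp]:
  "\<lbrakk>a \<in> carrier B; b \<in> carrier B\<rbrakk> \<Longrightarrow> \<chi> M (a \<ominus>\<^bsub>B\<^esub> b) = \<chi> M a - \<chi> M b"
  by (elim carrier_BE) (simp add: \<chi>_\<pi> keys_diff_subset flip: \<pi>_diff)

lemma \<chi>_X [simp]: "w \<in> lists V \<Longrightarrow> \<chi> M (\<xi> w) = (if set w \<subseteq> M then 1 else 0)"
  by (simp add: X_word_eq \<chi>_\<pi>)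

lemma X_single: "q \<in> V \<Longrightarrow> \<xi> [q] = X_gen Q q"
  by (simp add: X_Cons X_Nil)

lemma \<chi>_X_gen [simp]: "q \<in> V \<Longrightarrow> \<chi> M (X_gen Q q) = (if q \<in> M then 1 else 0)"
  using \<chi>_X[of "[q]" M] by (simp add: X_single)


subsection \<open>Consequences of the relations\<close>

text \<open>For a single letter \<open>t\<close> this is the third relation, as there is no arrow
  from \<open>s\<close> to \<open>t\<close>; for the empty word it is idempotence. For a longer word
  \<open>t # u\<close>, the induction hypothesis creates an additional \<open>s\<close> in front of
  \<open>u\<close>, the single-letter case absorbs the leading \<open>s\<close>, and the induction
  hypothesis deletes the auxiliary one.\<close>

lemma X_sink:
  assumes "s \<in> V" "u \<in> lists V" "\<And>t. t \<in> set u \<Longrightarrow> \<not> s \<rightarrow>\<^bsub>Q\<^esub> t"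
  shows "\<xi> (s # u @ [s]) = \<xi> (u @ [s])"
  using assms(2,3)
proof (induction u)
  case Nil
  show ?case
    using assms(1) \<pi>_eqI[of "word_poly [s, s]" "word_poly [s]"]
    by (auto simp: X_word_eq BQ_relations_def)
next
  case (Cons t u)
  then have tu: "t \<in> V" "u \<in> lists V" "\<not> s \<rightarrow>\<^bsub>Q\<^esub> t" by auto
  have u: "\<xi> (s # u @ [s]) = \<xi> (u @ [s])"
    using Cons by simp
  have "\<pi> (word_poly [s, t, s]) = \<pi> (word_poly [t, s])"
    by (rule \<pi>_eqI) (use tu assms(1) in \<open>auto simp: BQ_relations_def\<close>)
  then have sts: "\<xi> [s, t, s] = \<xi> [t, s]"
    using tu assms(1) by (simp add: X_word_eq)
  have "\<xi> (s # (t # u) @ [s]) = \<xi> [s, t] \<otimes>\<^bsub>B\<^esub> \<xi> (s # u @ [s])"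
    using X_append[of "[s, t]" "u @ [s]"] tu assms(1) by (simp add: u)
  also have "\<dots> = \<xi> [s, t, s] \<otimes>\<^bsub>B\<^esub> \<xi> (u @ [s])"
    using X_append[of "[s, t]" "s # u @ [s]"] X_append[of "[s, t, s]" "u @ [s]"] tu assms(1)
    by simp
  also have "\<dots> = \<xi> [t] \<otimes>\<^bsub>B\<^esub> \<xi> (s # u @ [s])"
    unfolding sts
    using X_append[of "[t]" "s # u @ [s]"] X_append[of "[t, s]" "u @ [s]"] tu assms(1)
    by simp
  also have "\<dots> = \<xi> ((t # u) @ [s])"
    using X_append[of "[t]" "u @ [s]"] tu assms(1) by (simp add: u)
  finally show ?case .
qed

text \<open>Both sides of the braid relation shorten by \<open>X_sink\<close>, one to each order of
  the two generators.\<close>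

lemma X_gen_commute:
  assumes "s \<in> V" "t \<in> V" "\<not> s \<rightarrow>\<^bsub>Q\<^esub> t" "\<not> t \<rightarrow>\<^bsub>Q\<^esub> s"
  shows "X_gen Q s \<otimes>\<^bsub>B\<^esub> X_gen Q t = X_gen Q t \<otimes>\<^bsub>B\<^esub> X_gen Q s"
proof -
  have "\<pi> (word_poly [s, t, s]) = \<pi> (word_poly [t, s, t])"
    by (rule \<pi>_eqI) (use assms in \<open>auto simp: BQ_relations_def\<close>)
  then have "\<xi> [s, t, s] = \<xi> [t, s, t]"
    using assms by (simp add: X_word_eq)
  then have "\<xi> [t, s] = \<xi> [s, t]"
    using X_sink[of s "[t]"] X_sink[of t "[s]"] assms by simp
  then show ?thesis
    using assms by (simp add: X_Cons X_Nil)
qed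

end


section \<open>Left modules\<close>

lemma (in abelian_group) a_inv_zero: "\<ominus> \<zero> = \<zero>"
  by (rule minus_equality) simp_all

lemma (in abelian_group) a_minus_eq_zeroD:
  assumes "x \<in> carrier G" "y \<in> carrier G" "x \<ominus> y = \<zero>"
  shows "x = y"
  using minus_equality[of x "\<ominus> y"] assms by (simp add: a_minus_def)

context left_module
begin

lemma smult_r_null [simp]: "a \<in> carrier R \<Longrightarrow> a \<odot>\<^bsub>M\<^esub> \<zero>\<^bsub>M\<^esub> = \<zero>\<^bsub>M\<^esub>"
  using smult_r_distr[of a "\<zero>\<^bsub>M\<^esub>" "\<zero>\<^bsub>M\<^esub>"] smult_closed[of a "\<zero>\<^bsub>M\<^esub>"]
  by (metis M.add.l_cancel_one' M.l_zero M.zero_closed)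

lemma smult_l_null [simp]: "x \<in> carrier M \<Longrightarrow> \<zero> \<odot>\<^bsub>M\<^esub> x = \<zero>\<^bsub>M\<^esub>"
  using smult_l_distr[of \<zero> \<zero> x] smult_closed[of \<zero> x]
  by (metis M.add.l_cancel_one' R.l_zero R.zero_closed)

lemma smult_r_minus:
  assumes "a \<in> carrier R" "x \<in> carrier M" "y \<in> carrier M"
  shows "a \<odot>\<^bsub>M\<^esub> (x \<ominus>\<^bsub>M\<^esub> y) = a \<odot>\<^bsub>M\<^esub> x \<ominus>\<^bsub>M\<^esub> a \<odot>\<^bsub>M\<^esub> y"
proof -
  have "a \<odot>\<^bsub>M\<^esub> (x \<ominus>\<^bsub>M\<^esub> y) \<oplus>\<^bsub>M\<^esub> a \<odot>\<^bsub>M\<^esub> y = a \<odot>\<^bsub>M\<^esub> x"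
    using assms by (simp add: smult_r_distr[symmetric] a_minus_def M.a_assoc M.l_neg)
  then show ?thesis
    using assms by (metis M.add.inv_closed M.a_assoc M.minus_closed M.r_neg M.r_zero a_minus_def smult_closed)
qed

lemma zero_submodule: "submodule {\<zero>\<^bsub>M\<^esub>} R M"
  by (intro submodule.intro submodule_axioms.intro M.add.subgroupI) auto

end

lemma submodule_closed:
  assumes "submodule H R M"
  shows "\<lbrakk>x \<in> H; y \<in> H\<rbrakk> \<Longrightarrow> x \<oplus>\<^bsub>M\<^esub> y \<in> H" "\<zero>\<^bsub>M\<^esub> \<in> H"
    "\<lbrakk>a \<in> carrier R; x \<in> H\<rbrakk> \<Longrightarrow> a \<odot>\<^bsub>M\<^esub> x \<in> H"
    "x \<in> H \<Longrightarrow> x \<in> carrier M"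
proof -
  interpret H: submodule H R M by fact
  show "\<lbrakk>x \<in> H; y \<in> H\<rbrakk> \<Longrightarrow> x \<oplus>\<^bsub>M\<^esub> y \<in> H" "\<zero>\<^bsub>M\<^esub> \<in> H"
    "\<lbrakk>a \<in> carrier R; x \<in> H\<rbrakk> \<Longrightarrow> a \<odot>\<^bsub>M\<^esub> x \<in> H"
    "x \<in> H \<Longrightarrow> x \<in> carrier M"
    using H.m_closed H.one_closed H.smult_closed H.subset by auto
qed

section \<open>The regular module and left ideals\<close>

definition regular_module :: "('a, 'm) ring_scheme \<Rightarrow> ('a, 'a) module" where
  "regular_module R = \<lparr>carrier = carrier R, mult = mult R, one = one R, ring.zero = ring.zero R,
     add = ring.add R, smult = mult R\<rparr>"

lemma regular_module_simps [simp]: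
  "carrier (regular_module R) = carrier R"
  "ring.add (regular_module R) = ring.add R"
  "ring.zero (regular_module R) = ring.zero R"
  "smult (regular_module R) = mult R"
  by (simp_all add: regular_module_def)

context ring
begin

lemma abelian_group_regular_module: "abelian_group (regular_module R)"
  by (rule abelian_groupI) (auto simp: a_ac intro: l_neg a_inv_closed)

text \<open>Together with \<open>left_ideal_submodule\<close>, this lets statements about a module
  modulo a submodule be applied to the ring modulo a left ideal.\<close>

lemma left_module_regular_module: "left_module R (regular_module R)"
  using abelian_group_regular_module
  by (intro left_module.intro left_module_axioms.intro ring_axioms)
    (auto simp: l_distr r_distr m_assoc)

lemma a_minus_regular_module:
  assumes "x \<in> carrier R" "y \<in> carrier R"
  shows "x \<ominus>\<^bsub>regular_module R\<^esub> y = x \<ominus> y"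
proof -
  interpret N: abelian_group "regular_module R" by (rule abelian_group_regular_module)
  have "\<ominus>\<^bsub>regular_module R\<^esub> y = \<ominus> y"
    using assms by (intro N.minus_equality) (auto simp: l_neg)
  then show ?thesis by (simp add: a_minus_def)
qed

lemma left_idealD:
  assumes "left_ideal L R"
  shows "x \<in> L \<Longrightarrow> x \<in> carrier R" "\<zero> \<in> L"
    "\<lbrakk>x \<in> L; y \<in> L\<rbrakk> \<Longrightarrow> x \<oplus>\<^bsub>R\<^esub> y \<in> L"
    "x \<in> L \<Longrightarrow> \<ominus> x \<in> L"
    "\<lbrakk>a \<in> carrier R; x \<in> L\<rbrakk> \<Longrightarrow> a \<otimes> x \<in> L"
proof -
  interpret L: additive_subgroup L R
    using assms by (rule left_ideal.axioms)
  show "x \<in> L \<Longrightarrow> x \<in> carrier R" "\<zero> \<in> L"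
    "\<lbrakk>x \<in> L; y \<in> L\<rbrakk> \<Longrightarrow> x \<oplus>\<^bsub>R\<^esub> y \<in> L"
    by auto
  show "x \<in> L \<Longrightarrow> \<ominus> x \<in> L"
    using subgroup.m_inv_closed[OF L.a_subgroup] by (simp add: a_inv_def)
  show "\<lbrakk>a \<in> carrier R; x \<in> L\<rbrakk> \<Longrightarrow> a \<otimes> x \<in> L"
    using assms by (rule left_ideal.I_l_closed)
qed

lemma left_ideal_submodule:
  assumes "left_ideal L R"
  shows "submodule L R (regular_module R)"
proof -
  interpret N: abelian_group "regular_module R" by (rule abelian_group_regular_module)
  note L = left_idealD[OF assms]
  have inv: "\<ominus>\<^bsub>regular_module R\<^esub> x = \<ominus> x" if "x \<in> carrier R" for x
    using that by (intro N.minus_equality) (auto simp: l_neg)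
  have "L \<noteq> {}" using L(2) by blast
  then have "subgroup L (add_monoid (regular_module R))"
    using L inv by (intro N.add.subgroupI) (auto simp flip: a_inv_def)
  then show ?thesis
    using L(5) by (intro submodule.intro submodule_axioms.intro) auto
qed

text \<open>Negation is multiplication by \<open>\<ominus> \<one>\<close>, so closure under it
  follows from closure under left multiplication.\<close>

lemma left_idealI:
  assumes "L \<subseteq> carrier R" "\<zero> \<in> L" "\<And>x y. \<lbrakk>x \<in> L; y \<in> L\<rbrakk> \<Longrightarrow> x \<oplus>\<^bsub>R\<^esub> y \<in> L"
    "\<And>a x. \<lbrakk>a \<in> carrier R; x \<in> L\<rbrakk> \<Longrightarrow> a \<otimes> x \<in> L"
  shows "left_ideal L R"
proof -
  have "\<ominus> x \<in> L" if "x \<in> L" for x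
    using assms(4)[of "\<ominus> \<one>" x] that assms(1) by (auto simp: l_minus)
  then have "subgroup L (add_monoid R)"
    using assms by (intro add.subgroupI) (auto simp flip: a_inv_def)
  then show ?thesis
    using assms by (intro left_ideal.intro additive_subgroup.intro left_ideal_axioms.intro ring_axioms) auto
qed

end


section \<open>Joint eigenvectors of the generators modulo a submodule\<close>

context quiver_algebra
begin

text \<open>
  Among the letters in \<open>U\<close> take a sink \<open>s\<close>: since \<open>X\<^sub>s X\<^sub>w X\<^sub>s = X\<^sub>w X\<^sub>s\<close> for every word \<open>w\<close> over \<open>U\<close>,
  applying \<open>X\<^sub>s\<close> to a joint eigenvector of the other letters and then restoring that property by
  some \<open>X\<^sub>w\<close> preserves the eigenvalue \<open>1\<close> of \<open>X\<^sub>s\<close>.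
\<close>

lemma exists_eigen_letters:
  assumes S: "left_module B S" and H: "submodule H B S"
    and "U \<subseteq> V" "x \<in> carrier S" "x \<notin> H"
  shows "\<exists>w\<in>lists U. \<xi> w \<odot>\<^bsub>S\<^esub> x \<notin> H \<and>
    (\<forall>q\<in>U. X_gen Q q \<odot>\<^bsub>S\<^esub> (\<xi> w \<odot>\<^bsub>S\<^esub> x) \<in> H \<or>
      X_gen Q q \<odot>\<^bsub>S\<^esub> (\<xi> w \<odot>\<^bsub>S\<^esub> x) \<ominus>\<^bsub>S\<^esub> \<xi> w \<odot>\<^bsub>S\<^esub> x \<in> H)"
proof -
  interpret S: left_module B S by (rule S)
  note H = submodule_closed[OF H]
  have "finite U"
    using finite_V assms(3) by (rule rev_finite_subset)
  from this assms(3-5) show ?thesis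
  proof (induction U arbitrary: x rule: finite_psubset_induct)
    case (psubset U)
    show ?case
    proof (cases "U = {}")
      case True
      then show ?thesis
        using psubset.prems by (intro bexI[of _ "[]"]) (simp_all add: X_Nil S.smult_one)
    next
      case False
      then obtain s where s: "s \<in> U" "\<And>t. t \<in> U \<Longrightarrow> \<not> s \<rightarrow>\<^bsub>Q\<^esub> t"
        using exists_sink[OF fin_digraph acyclic psubset.prems(1)] by blast
      let ?good = "\<lambda>U y. \<forall>q\<in>U. X_gen Q q \<odot>\<^bsub>S\<^esub> y \<in> H \<or> X_gen Q q \<odot>\<^bsub>S\<^esub> y \<ominus>\<^bsub>S\<^esub> y \<in> H"
      have IH: "\<exists>w\<in>lists (U - {s}). \<xi> w \<odot>\<^bsub>S\<^esub> z \<notin> H \<and> ?good (U - {s}) (\<xi> w \<odot>\<^bsub>S\<^esub> z)"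
        if "z \<in> carrier S" "z \<notin> H" for z
        using psubset.IH[of "U - {s}" z] s(1) psubset.prems(1) that by blast
      obtain w where w: "w \<in> lists (U - {s})" "\<xi> w \<odot>\<^bsub>S\<^esub> x \<notin> H" "?good (U - {s}) (\<xi> w \<odot>\<^bsub>S\<^esub> x)"
        using IH psubset.prems by blast
      let ?y = "\<xi> w \<odot>\<^bsub>S\<^esub> x"
      have V: "w \<in> lists V" "s \<in> V" "w \<in> lists U"
        using w(1) s(1) psubset.prems(1) by auto
      have y: "?y \<in> carrier S"
        using V psubset.prems by (simp add: S.smult_closed)
      show ?thesis
      proof (cases "?good {s} ?y")
        case True
        then have "?good U ?y"
          using w(3) by blast
        then show ?thesis
          using w(2) V(3) by (intro bexI[of _ w] conjI)
      next
        case False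
        \<comment> \<open>Failure for \<open>s\<close> means in particular that this vector lies
          outside \<open>H\<close>, so the induction hypothesis for the remaining letters may be
          applied to it as a new starting vector.\<close>
        then have "X_gen Q s \<odot>\<^bsub>S\<^esub> ?y \<notin> H" by auto
        with IH[of "X_gen Q s \<odot>\<^bsub>S\<^esub> ?y"] y V obtain v where v: "v \<in> lists (U - {s})"
          "\<xi> v \<odot>\<^bsub>S\<^esub> (X_gen Q s \<odot>\<^bsub>S\<^esub> ?y) \<notin> H" "?good (U - {s}) (\<xi> v \<odot>\<^bsub>S\<^esub> (X_gen Q s \<odot>\<^bsub>S\<^esub> ?y))"
          by (auto simp: S.smult_closed)
        have vV: "v \<in> lists V" "v \<in> lists U"
          using v(1) psubset.prems(1) by auto
        let ?z = "\<xi> v \<odot>\<^bsub>S\<^esub> (X_gen Q s \<odot>\<^bsub>S\<^esub> ?y)"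
        have z: "?z = \<xi> (v @ [s]) \<odot>\<^bsub>S\<^esub> ?y"
          using vV V y by (simp add: X_append X_single S.smult_assoc)
        have zx: "?z = \<xi> (v @ [s] @ w) \<odot>\<^bsub>S\<^esub> x"
          using vV V psubset.prems(2) X_append[of "v @ [s]" w]
          by (simp add: z S.smult_assoc)
        have zc: "?z \<in> carrier S"
          using vV V y by (simp add: S.smult_closed)
        have "\<xi> (s # v @ [s]) = \<xi> (v @ [s])"
          using vV V s(2) by (intro X_sink) auto
        then have "X_gen Q s \<odot>\<^bsub>S\<^esub> ?z = ?z"
          using vV V y by (simp add: z X_Cons flip: S.smult_assoc)
        then have "X_gen Q s \<odot>\<^bsub>S\<^esub> ?z \<ominus>\<^bsub>S\<^esub> ?z \<in> H"
          using zc H(2) by (simp add: a_minus_def S.M.r_neg)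
        then have "?good U ?z"
          using v(3) by blast
        then show ?thesis
          using v(2) vV V s(1) unfolding zx by (intro bexI[of _ "v @ [s] @ w"] conjI) simp_all
      qed
    qed
  qed
qed

text \<open>Take \<open>y\<close> from \<open>exists_eigen_letters\<close> for all of
  \<open>V\<close> and let \<open>M\<close> consist of the letters fixing \<open>y\<close> modulo
  \<open>H\<close>; the other letters send \<open>y\<close> into \<open>H\<close>. The elements
  acting on \<open>y\<close> through the character modulo \<open>H\<close> include scalars and
  generators and are closed under products and sums, so they are all of \<open>B\<close>.\<close>

lemma exists_eigenvector:
  assumes S: "left_module B S" and H: "submodule H B S" and x: "x \<in> carrier S" "x \<notin> H"
  obtains y M where "y \<in> carrier S" "y \<notin> H" "M \<subseteq> V"
    "\<And>b. b \<in> carrier B \<Longrightarrow> b \<odot>\<^bsub>S\<^esub> y \<ominus>\<^bsub>S\<^esub> scalar (\<chi> M b) \<odot>\<^bsub>S\<^esub> y \<in> H"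
proof -
  interpret S: left_module B S by (rule S)
  note H' = submodule_closed[OF H]
  obtain w where w: "w \<in> lists V" and notin: "\<xi> w \<odot>\<^bsub>S\<^esub> x \<notin> H"
    and eigen: "\<And>q. q \<in> V \<Longrightarrow> X_gen Q q \<odot>\<^bsub>S\<^esub> (\<xi> w \<odot>\<^bsub>S\<^esub> x) \<in> H \<or>
      X_gen Q q \<odot>\<^bsub>S\<^esub> (\<xi> w \<odot>\<^bsub>S\<^esub> x) \<ominus>\<^bsub>S\<^esub> \<xi> w \<odot>\<^bsub>S\<^esub> x \<in> H"
    using exists_eigen_letters[OF S H subset_refl x] by blast
  define y where "y = \<xi> w \<odot>\<^bsub>S\<^esub> x"
  define M where "M = {q \<in> V. X_gen Q q \<odot>\<^bsub>S\<^esub> y \<ominus>\<^bsub>S\<^esub> y \<in> H}"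
  have y: "y \<in> carrier S"
    using w x by (simp add: y_def S.smult_closed)
  let ?P = "\<lambda>b. b \<odot>\<^bsub>S\<^esub> y \<ominus>\<^bsub>S\<^esub> scalar (\<chi> M b) \<odot>\<^bsub>S\<^esub> y \<in> H"
  have scalar: "?P (scalar c)" for c
    using y H'(2) by (simp add: a_minus_def S.M.r_neg S.smult_closed)
  have gen: "?P (X_gen Q q)" if "q \<in> V" for q
  proof (cases "q \<in> M")
    case True
    then show ?thesis
      using that y by (simp add: M_def scalar_1 S.smult_one)
  next
    case False
    then have "X_gen Q q \<odot>\<^bsub>S\<^esub> y \<in> H"
      using eigen[OF that] that by (simp add: M_def y_def)
    then show ?thesis
      using that y False by (simp add: a_minus_def S.smult_closed S.M.a_inv_zero)
  qed
  have telescope: "(u \<ominus>\<^bsub>S\<^esub> v) \<oplus>\<^bsub>S\<^esub> (v \<ominus>\<^bsub>S\<^esub> t) = u \<ominus>\<^bsub>S\<^esub> t"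
    if "u \<in> carrier S" "v \<in> carrier S" "t \<in> carrier S" for u v t
    using that by (simp add: a_minus_def S.M.a_assoc S.M.r_neg1)
  \<comment> \<open>Let c and d be the values of the character at a and b. Since d is central, ab y
    - cd y = a (b y - d y) + d (a y - c y), and both summands lie in \<open>H\<close>.\<close>
  have mult: "?P (a \<otimes>\<^bsub>B\<^esub> b)" if "a \<in> carrier B" "b \<in> carrier B" "?P a" "?P b" for a b
  proof -
    let ?c = "scalar (\<chi> M a)" and ?d = "scalar (\<chi> M b)"
    have 1: "a \<odot>\<^bsub>S\<^esub> (b \<odot>\<^bsub>S\<^esub> y \<ominus>\<^bsub>S\<^esub> ?d \<odot>\<^bsub>S\<^esub> y) \<in> H" "?d \<odot>\<^bsub>S\<^esub> (a \<odot>\<^bsub>S\<^esub> y \<ominus>\<^bsub>S\<^esub> ?c \<odot>\<^bsub>S\<^esub> y) \<in> H"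
      using that by (simp_all add: H'(3))
    have 2: "a \<odot>\<^bsub>S\<^esub> (b \<odot>\<^bsub>S\<^esub> y \<ominus>\<^bsub>S\<^esub> ?d \<odot>\<^bsub>S\<^esub> y) = (a \<otimes>\<^bsub>B\<^esub> b) \<odot>\<^bsub>S\<^esub> y \<ominus>\<^bsub>S\<^esub> (a \<otimes>\<^bsub>B\<^esub> ?d) \<odot>\<^bsub>S\<^esub> y"
      using that y by (simp add: S.smult_r_minus S.smult_closed S.smult_assoc)
    have 3: "?d \<odot>\<^bsub>S\<^esub> (a \<odot>\<^bsub>S\<^esub> y \<ominus>\<^bsub>S\<^esub> ?c \<odot>\<^bsub>S\<^esub> y) = (a \<otimes>\<^bsub>B\<^esub> ?d) \<odot>\<^bsub>S\<^esub> y \<ominus>\<^bsub>S\<^esub> scalar (\<chi> M (a \<otimes>\<^bsub>B\<^esub> b)) \<odot>\<^bsub>S\<^esub> y"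
      using that y scalar_commute[of a "\<chi> M b"]
      by (simp add: S.smult_r_minus S.smult_closed mult.commute[of "\<chi> M a"] scalar_mult
          flip: S.smult_assoc)
    show ?thesis
      using H'(1)[OF 1] unfolding 2 3
      using that y by (simp add: telescope S.smult_closed del: \<chi>_mult)
  qed
  have word: "?P (\<xi> u)" if "u \<in> lists V" for u
    using that
  proof (induction u)
    case Nil
    show ?case using scalar[of 1] by (simp add: X_Nil scalar_1)
  next
    case (Cons q u)
    then show ?case
      using mult[of "X_gen Q q" "\<xi> u"] gen[of q] by (simp add: X_Cons del: \<chi>_X \<chi>_X_gen \<chi>_mult)
  qed
  have "?P b" if "b \<in> carrier B" for b
    using that
  proof (induction rule: B_induct)
    case (smult u c)
    then show ?case by (intro mult scalar word) simp_all
  next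
    case (add a b)
    have "(a \<oplus>\<^bsub>B\<^esub> b) \<odot>\<^bsub>S\<^esub> y \<ominus>\<^bsub>S\<^esub> scalar (\<chi> M (a \<oplus>\<^bsub>B\<^esub> b)) \<odot>\<^bsub>S\<^esub> y =
      (a \<odot>\<^bsub>S\<^esub> y \<ominus>\<^bsub>S\<^esub> scalar (\<chi> M a) \<odot>\<^bsub>S\<^esub> y) \<oplus>\<^bsub>S\<^esub> (b \<odot>\<^bsub>S\<^esub> y \<ominus>\<^bsub>S\<^esub> scalar (\<chi> M b) \<odot>\<^bsub>S\<^esub> y)"
      using add y
      by (simp add: scalar_add S.smult_l_distr S.smult_closed a_minus_def S.M.minus_add S.M.a_ac)
    then show ?case using H'(1)[OF add.IH] by simp
  qed
  then show ?thesis
    using that[of y M] y notin by (auto simp: y_def M_def)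
qed

subsection \<open>The simple modules\<close>

abbreviation EM :: "'v set \<Rightarrow> (('v list \<Rightarrow>\<^sub>0 'k) set, 'k) module"
  where "EM \<equiv> E_module"

lemma E_module_simps [simp]:
  "carrier (EM M) = UNIV"
  "x \<oplus>\<^bsub>EM M\<^esub> y = x + y"
  "\<zero>\<^bsub>EM M\<^esub> = 0"
  "b \<odot>\<^bsub>EM M\<^esub> x = \<chi> M b * x"
  by (simp_all add: E_module_def)

lemma left_module_E_module: "left_module B (EM M)"
proof (intro left_module.intro left_module_axioms.intro B.ring_axioms)
  show "abelian_group (EM M)"
  proof (rule abelian_groupI)
    show "\<exists>y\<in>carrier (EM M). y \<oplus>\<^bsub>EM M\<^esub> x = \<zero>\<^bsub>EM M\<^esub>"
      for x :: 'k
      by (intro bexI[of _ "- x"]) auto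
  qed (simp_all add: ac_simps)
qed (simp_all add: algebra_simps)

text \<open>The scalars alone act as all of the field, so a submodule with a nonzero element is
  everything.\<close>

lemma simple_E_module:
  "simple_left_module B (EM M)"
proof -
  have 1: "H = {0} \<or> H = UNIV" if "submodule H B (EM M)" for H
  proof (cases "\<exists>x\<in>H. x \<noteq> 0")
    case True
    then obtain x where x: "x \<in> H" "x \<noteq> 0" by blast
    have "c \<in> H" for c
      using submodule_closed(3)[OF that scalar_closed[of "c / x"] x(1)] x(2)
      by simp
    then show ?thesis by auto
  next
    case False
    then show ?thesis
      using submodule_closed(2)[OF that] by auto
  qed
  have 2: "(UNIV :: 'k set) \<noteq> {0}"
    by (metis UNIV_I singletonD zero_neq_one)
  show ?thesis
    unfolding simple_left_module_def E_module_simps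
    by (intro conjI allI impI left_module_E_module 1 2)
qed

text \<open>An isomorphism \<open>h\<close> sends the value of one character at \<open>b\<close> to
  a nonzero multiple, by \<open>h 1\<close>, of the value of the other. Hence both vanish on the
  same elements, and the generators detect the letters.\<close>

lemma E_module_inject:
  assumes "M \<subseteq> V" "N \<subseteq> V"
    "isomorphic_modules B (EM M)
      (EM N)"
  shows "M = N"
proof -
  obtain h :: "'k \<Rightarrow> 'k" where h: "bij h" "\<And>x y. h (x + y) = h x + h y"
    "\<And>b x. b \<in> carrier B \<Longrightarrow> h (\<chi> M b * x) = \<chi> N b * h x"
    using assms(3) by (auto simp: isomorphic_modules_def)
  have h0: "h 0 = 0"
    using h(2)[of 0 0] by (metis add_0 add_cancel_left_left)
  have "h 1 \<noteq> 0"
    using h(1) h0 by (metis bij_is_inj inj_eq zero_neq_one)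
  then have "\<chi> M b = 0 \<longleftrightarrow> \<chi> N b = 0" if "b \<in> carrier B" for b
    using h(3)[OF that, of 1] h0 h(1) by (metis bij_is_inj inj_eq mult_eq_0_iff mult.right_neutral)
  then have "q \<in> M \<longleftrightarrow> q \<in> N" if "q \<in> V" for q
    using that \<chi>_X_gen[OF that, of M] \<chi>_X_gen[OF that, of N] X_gen_closed[OF that]
    by (metis zero_neq_one)
  with assms(1,2) show ?thesis by auto
qed

text \<open>For an eigenvector \<open>y\<close> modulo the zero submodule, the scalar multiples of
  \<open>y\<close> form a nonzero submodule, which simplicity makes the whole module. The map
  \<open>g\<close> from scalars to multiples is injective because nonzero scalars are invertible;
  its inverse is the isomorphism.\<close>

lemma simple_left_module_iso_E_module:
  fixes S :: "(('v list \<Rightarrow>\<^sub>0 'k) set, 'n, 'p) module_scheme"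
  assumes "simple_left_module B S"
  obtains M where "M \<subseteq> V" "isomorphic_modules B S (EM M)"
proof -
  have S: "left_module B S" and nonzero: "carrier S \<noteq> {\<zero>\<^bsub>S\<^esub>}"
    and simple: "\<And>H. submodule H B S \<Longrightarrow> H = {\<zero>\<^bsub>S\<^esub>} \<or> H = carrier S"
    using assms by (auto simp: simple_left_module_def)
  interpret S: left_module B S by (rule S)
  obtain x where "x \<in> carrier S" "x \<notin> {\<zero>\<^bsub>S\<^esub>}"
    using nonzero S.M.zero_closed by blast
  then obtain y M where y: "y \<in> carrier S" "y \<noteq> \<zero>\<^bsub>S\<^esub>" and M: "M \<subseteq> V"
    and eigen: "\<And>b. b \<in> carrier B \<Longrightarrow> b \<odot>\<^bsub>S\<^esub> y \<ominus>\<^bsub>S\<^esub> scalar (\<chi> M b) \<odot>\<^bsub>S\<^esub> y \<in> {\<zero>\<^bsub>S\<^esub>}"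
    using exists_eigenvector[OF S S.zero_submodule] by (metis singletonI)
  define g where "g c = scalar c \<odot>\<^bsub>S\<^esub> y" for c
  have g_closed [simp]: "g c \<in> carrier S" for c
    using y by (simp add: g_def S.smult_closed)
  have g_add: "g (c + d) = g c \<oplus>\<^bsub>S\<^esub> g d" for c d
    using y by (simp add: g_def scalar_add S.smult_l_distr)
  have g_mult: "g (c * d) = scalar c \<odot>\<^bsub>S\<^esub> g d" for c d
    using y by (simp add: g_def scalar_mult S.smult_assoc)
  have g_0: "g 0 = \<zero>\<^bsub>S\<^esub>" and g_1: "g 1 = y"
    using y by (simp_all add: g_def scalar_1 S.smult_one)
  have b_y: "b \<odot>\<^bsub>S\<^esub> y = g (\<chi> M b)" if "b \<in> carrier B" for b
    using S.M.a_minus_eq_zeroD[OF _ _ singletonD[OF eigen[OF that]]] y that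
    by (simp add: g_def S.smult_closed)
  have g_smult: "b \<odot>\<^bsub>S\<^esub> g c = g (\<chi> M b * c)" if "b \<in> carrier B" for b c
  proof -
    have "b \<odot>\<^bsub>S\<^esub> g c = scalar c \<odot>\<^bsub>S\<^esub> (b \<odot>\<^bsub>S\<^esub> y)"
      using that y scalar_commute[OF that, of c] by (simp add: g_def flip: S.smult_assoc)
    then show ?thesis
      by (simp add: b_y that g_mult[symmetric] mult.commute)
  qed
  have "inj g"
  proof (rule injI, rule ccontr)
    fix c d assume eq: "g c = g d" and "c \<noteq> d"
    have "g (c - d) \<oplus>\<^bsub>S\<^esub> g d = \<zero>\<^bsub>S\<^esub> \<oplus>\<^bsub>S\<^esub> g d"
      using g_add[of "c - d" d] eq by simp
    then have "g (c - d) = \<zero>\<^bsub>S\<^esub>"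
      by (simp only: S.M.add.r_cancel g_closed S.M.zero_closed)
    then have "g (inverse (c - d) * (c - d)) = \<zero>\<^bsub>S\<^esub>"
      unfolding g_mult by simp
    then show False
      using \<open>c \<noteq> d\<close> g_1 y by simp
  qed
  have "submodule (range g) B S"
  proof (intro submodule.intro submodule_axioms.intro S.M.add.subgroupI)
    show "\<ominus>\<^bsub>S\<^esub> x \<in> range g" if x: "x \<in> range g" for x
    proof -
      obtain c where "x = g c" using x by blast
      then have "g (- c) \<oplus>\<^bsub>S\<^esub> x = \<zero>\<^bsub>S\<^esub>"
        using g_add[of "- c" c] g_0 by simp
      then have "\<ominus>\<^bsub>S\<^esub> x = g (- c)"
        using \<open>x = g c\<close> by (intro S.M.minus_equality) auto
      then show ?thesis by simp
    qed
  qed (auto simp: g_smult simp flip: g_add)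
  then have range: "range g = carrier S"
    using simple[of "range g"] g_1 y by blast
  define h where "h = inv_into UNIV g"
  have h: "h (g c) = c" for c
    using \<open>inj g\<close> by (simp add: h_def)
  have "bij_betw h (carrier S) UNIV"
    unfolding h_def using \<open>inj g\<close> range by (intro bij_betw_inv_into) (auto simp: bij_betw_def)
  moreover have "\<forall>x\<in>range g. \<forall>z\<in>range g. h (x \<oplus>\<^bsub>S\<^esub> z) = h x + h z"
    by (auto simp: h simp flip: g_add)
  moreover have "\<forall>b\<in>carrier B. \<forall>x\<in>range g. h (b \<odot>\<^bsub>S\<^esub> x) = \<chi> M b * h x"
    by (auto simp: h g_smult)
  ultimately have "isomorphic_modules B S (EM M)"
    unfolding isomorphic_modules_def range by (intro exI[of _ h]) simp
  with M show ?thesis by (rule that)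
qed


subsection \<open>The radical as a common kernel\<close>

text \<open>The kernel has codimension one: if \<open>b\<close> lies outside it, any
  \<open>a\<close> differs by an element of the kernel from the multiple of \<open>b\<close> that
  has the same value under the character.\<close>

lemma maximal_left_ideal_kernel:
  "maximal_left_ideal {b \<in> carrier B. \<chi> M b = 0} B"
proof -
  let ?L = "{b \<in> carrier B. \<chi> M b = 0}"
  have "\<one>\<^bsub>B\<^esub> \<notin> ?L" by simp
  then have "?L \<noteq> carrier B"
    using B.one_closed by blast
  moreover have "left_ideal ?L B"
    by (rule B.left_idealI) auto
  moreover have "J = carrier B" if J: "left_ideal J B" "?L \<subseteq> J" "J \<noteq> ?L" for J
  proof -
    note J' = B.left_idealD[OF J(1)]
    obtain b where "b \<in> J" "b \<notin> ?L"
      using J(2,3) by blast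
    then have b: "b \<in> J" "\<chi> M b \<noteq> 0" and bc: "b \<in> carrier B"
      using J'(1) by auto
    let ?c = "scalar (inverse (\<chi> M b))"
    have "a \<in> J" if a: "a \<in> carrier B" for a
    proof -
      let ?d = "(a \<otimes>\<^bsub>B\<^esub> ?c) \<otimes>\<^bsub>B\<^esub> b"
      have "a \<ominus>\<^bsub>B\<^esub> ?d \<in> J"
        by (rule subsetD[OF J(2)]) (use a bc b in simp)
      moreover have "?d \<in> J"
        using a b by (intro J'(5)) simp_all
      ultimately have "(a \<ominus>\<^bsub>B\<^esub> ?d) \<oplus>\<^bsub>B\<^esub> ?d \<in> J"
        by (rule J'(3))
      then show ?thesis
        using a bc by (simp add: a_minus_def B.a_assoc B.l_neg)
    qed
    then show ?thesis using J'(1) by blast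
  qed
  ultimately show ?thesis
    unfolding maximal_left_ideal_def by blast
qed

text \<open>Choose \<open>y\<close> outside \<open>L\<close> on which \<open>B\<close> acts through
  a character modulo \<open>L\<close>. By maximality By + L = B, so 1 = by + l with l in
  \<open>L\<close>. Then j = (jb)y + jl, where (jb)y lies in \<open>L\<close> because the character
  vanishes at jb.\<close>

lemma maximal_left_ideal_contains:
  assumes L: "maximal_left_ideal L B" and j: "j \<in> carrier B" "\<And>M. M \<subseteq> V \<Longrightarrow> \<chi> M j = 0"
  shows "j \<in> L"
proof -
  have "left_ideal L B"
    using L by (simp add: maximal_left_ideal_def)
  note L' = B.left_idealD[OF this] and Lsub = B.left_ideal_submodule[OF this]
  have "L \<noteq> carrier B"
    using L by (simp add: maximal_left_ideal_def)
  then obtain x where x: "x \<in> carrier B" "x \<notin> L"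
    using L'(1) by blast
  obtain y M where y: "y \<in> carrier B" "y \<notin> L" and M: "M \<subseteq> V"
    and eigen: "\<And>b. b \<in> carrier B \<Longrightarrow> b \<otimes>\<^bsub>B\<^esub> y \<ominus>\<^bsub>B\<^esub> scalar (\<chi> M b) \<otimes>\<^bsub>B\<^esub> y \<in> L"
    using exists_eigenvector[OF B.left_module_regular_module Lsub, of x] x
    by (auto simp: B.a_minus_regular_module)
  let ?J = "{b \<otimes>\<^bsub>B\<^esub> y \<oplus>\<^bsub>B\<^esub> l | b l. b \<in> carrier B \<and> l \<in> L}"
  note Lc = L'(1)
  have memI: "z \<in> ?J" if "b \<in> carrier B" "l \<in> L" "z = b \<otimes>\<^bsub>B\<^esub> y \<oplus>\<^bsub>B\<^esub> l" for z b l
    using that by blast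
  have "left_ideal ?J B"
  proof (rule B.left_idealI)
    show "?J \<subseteq> carrier B"
      using y Lc by auto
    show "\<zero>\<^bsub>B\<^esub> \<in> ?J"
      by (rule memI[OF B.zero_closed L'(2)]) (use y in simp)
    show "u \<oplus>\<^bsub>B\<^esub> v \<in> ?J" if uv: "u \<in> ?J" "v \<in> ?J" for u v
    proof -
      obtain a l b m where *: "u = a \<otimes>\<^bsub>B\<^esub> y \<oplus>\<^bsub>B\<^esub> l" "v = b \<otimes>\<^bsub>B\<^esub> y \<oplus>\<^bsub>B\<^esub> m"
        "a \<in> carrier B" "l \<in> L" "b \<in> carrier B" "m \<in> L"
        using uv by blast
      have "u \<oplus>\<^bsub>B\<^esub> v = (a \<oplus>\<^bsub>B\<^esub> b) \<otimes>\<^bsub>B\<^esub> y \<oplus>\<^bsub>B\<^esub> (l \<oplus>\<^bsub>B\<^esub> m)"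
        using * y Lc by (simp add: B.l_distr B.a_ac)
      then show ?thesis
        by (rule memI[rotated 2]) (use * L'(3) in auto)
    qed
    show "a \<otimes>\<^bsub>B\<^esub> u \<in> ?J" if au: "a \<in> carrier B" "u \<in> ?J" for a u
    proof -
      obtain b l where *: "u = b \<otimes>\<^bsub>B\<^esub> y \<oplus>\<^bsub>B\<^esub> l" "b \<in> carrier B" "l \<in> L"
        using au by blast
      then have "a \<otimes>\<^bsub>B\<^esub> u = (a \<otimes>\<^bsub>B\<^esub> b) \<otimes>\<^bsub>B\<^esub> y \<oplus>\<^bsub>B\<^esub> a \<otimes>\<^bsub>B\<^esub> l"
        using y Lc au by (simp add: B.r_distr B.m_assoc)
      then show ?thesis
        by (rule memI[rotated 2]) (use * au L'(5) in auto)
    qed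
  qed
  moreover have "L \<subseteq> ?J"
  proof
    fix l assume "l \<in> L"
    with B.zero_closed show "l \<in> ?J"
      by (rule memI) (use y Lc[OF \<open>l \<in> L\<close>] in simp)
  qed
  moreover have "y \<in> ?J"
    by (rule memI[OF B.one_closed L'(2)]) (use y in simp)
  ultimately have "?J = carrier B"
    using L y by (metis (no_types, lifting) maximal_left_ideal_def)
  then obtain b l where bl: "\<one>\<^bsub>B\<^esub> = b \<otimes>\<^bsub>B\<^esub> y \<oplus>\<^bsub>B\<^esub> l" "b \<in> carrier B" "l \<in> L"
    using B.one_closed by blast
  have "(j \<otimes>\<^bsub>B\<^esub> b) \<otimes>\<^bsub>B\<^esub> y \<in> L"
    using eigen[of "j \<otimes>\<^bsub>B\<^esub> b"] j M bl(2) y by (simp add: a_minus_def)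
  then have "(j \<otimes>\<^bsub>B\<^esub> b) \<otimes>\<^bsub>B\<^esub> y \<oplus>\<^bsub>B\<^esub> j \<otimes>\<^bsub>B\<^esub> l \<in> L"
    by (rule L'(3)[OF _ L'(5)[OF j(1) bl(3)]])
  also have "(j \<otimes>\<^bsub>B\<^esub> b) \<otimes>\<^bsub>B\<^esub> y \<oplus>\<^bsub>B\<^esub> j \<otimes>\<^bsub>B\<^esub> l = j \<otimes>\<^bsub>B\<^esub> \<one>\<^bsub>B\<^esub>"
    using bl y j Lc by (simp add: B.r_distr B.m_assoc)
  finally show ?thesis using j by simp
qed

lemma radical_eq: "radical B = {b \<in> carrier B. \<forall>M\<subseteq>V. \<chi> M b = 0}"
proof (intro equalityI subsetI)
  fix b assume b: "b \<in> radical B"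
  have "b \<in> {b \<in> carrier B. \<chi> M b = 0}" for M
    using b unfolding radical_def by (rule InterD[OF IntD2]) (rule CollectI, rule maximal_left_ideal_kernel)
  then show "b \<in> {b \<in> carrier B. \<forall>M\<subseteq>V. \<chi> M b = 0}"
    by simp
next
  fix b assume "b \<in> {b \<in> carrier B. \<forall>M\<subseteq>V. \<chi> M b = 0}"
  then show "b \<in> radical B"
    using maximal_left_ideal_contains[of _ b] by (simp add: radical_def)
qed

end


section \<open>Linear spans\<close>

context ring
begin

lemma linear_span_base:
  assumes "subfield K R" "S \<subseteq> carrier R" "x \<in> S"
  shows "x \<in> linear_span K R S"
proof -
  have "set [x] \<subseteq> carrier R"
    using assms(2,3) by auto
  then have "x \<in> Span K [x]"
    using Span_base_incl[OF assms(1)] by (simp del: Span.simps add: subset_iff)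
  then show ?thesis
    unfolding linear_span_def by (rule UN_I[rotated]) (simp add: assms(3))
qed

lemma linear_span_zero: "\<zero> \<in> linear_span K R S"
  unfolding linear_span_def by (intro UN_I[of "[]"]) auto

text \<open>The two elements may come from different finite lists; both lie in the span of the
  concatenation.\<close>

lemma linear_span_add:
  assumes K: "subfield K R" and S: "S \<subseteq> carrier R"
    and x: "x \<in> linear_span K R S" and y: "y \<in> linear_span K R S"
  shows "x \<oplus>\<^bsub>R\<^esub> y \<in> linear_span K R S"
proof -
  obtain Us Vs where Us: "set Us \<subseteq> S" "x \<in> Span K Us" and Vs: "set Vs \<subseteq> S" "y \<in> Span K Vs"
    using x y unfolding linear_span_def by blast
  have carr: "set Us \<subseteq> carrier R" "set Vs \<subseteq> carrier R" "set (Us @ Vs) \<subseteq> carrier R"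
    using Us Vs S by auto
  have "x \<in> Span K (Us @ Vs)" "y \<in> Span K (Us @ Vs)"
    using mono_Span_append(1)[OF K carr(1,2)] mono_Span_append(2)[OF K carr(2,1)] Us(2) Vs(2) by blast+
  then have "x \<oplus>\<^bsub>R\<^esub> y \<in> Span K (Us @ Vs)"
    by (rule Span_subgroup_props(3)[OF K carr(3)])
  then show ?thesis
    unfolding linear_span_def by (rule UN_I[rotated]) (use Us Vs in auto)
qed

lemma linear_span_smult:
  assumes K: "subfield K R" and S: "S \<subseteq> carrier R"
    and "k \<in> K" "x \<in> linear_span K R S"
  shows "k \<otimes> x \<in> linear_span K R S"
proof -
  obtain Us where Us: "set Us \<subseteq> S" "x \<in> Span K Us"
    using assms(4) unfolding linear_span_def by blast
  have "k \<otimes> x \<in> Span K Us"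
    by (rule Span_smult_closed[OF K _ assms(3) Us(2)]) (use Us(1) S in auto)
  then show ?thesis
    unfolding linear_span_def by (rule UN_I[rotated]) (use Us in auto)
qed

lemma linear_span_subset:
  assumes "S \<subseteq> E" "\<zero> \<in> E" "\<And>x y. \<lbrakk>x \<in> E; y \<in> E\<rbrakk> \<Longrightarrow> x \<oplus>\<^bsub>R\<^esub> y \<in> E"
    "\<And>k x. \<lbrakk>k \<in> K; x \<in> E\<rbrakk> \<Longrightarrow> k \<otimes> x \<in> E"
  shows "linear_span K R S \<subseteq> E"
proof -
  have "Span K Us \<subseteq> E" if "set Us \<subseteq> S" for Us
    using that
  proof (induction Us)
    case Nil
    show ?case using assms(2) by simp
  next
    case (Cons u Us)
    have Us: "Span K Us \<subseteq> E" and u: "u \<in> E"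
      using Cons assms(1) by auto
    have "x \<in> E" if x: "x \<in> line_extension K u (Span K Us)" for x
    proof -
      obtain k v where "k \<in> K" "v \<in> Span K Us" "x = k \<otimes> u \<oplus>\<^bsub>R\<^esub> v"
        using x unfolding line_extension_mem_iff by blast
      then show ?thesis
        using Us u assms(3)[of "k \<otimes> u" v] assms(4)[of k u] by blast
    qed
    then show ?case by auto
  qed
  then show ?thesis unfolding linear_span_def by blast
qed

end


section \<open>Fields as rings with carrier\<close>

text \<open>The coefficient field as a ring record, so that characters become ring homomorphisms
  between records.\<close>

definition field_ring :: "'a::field ring" where
  "field_ring = \<lparr>carrier = UNIV, mult = (*), one = 1, ring.zero = 0, add = (+)\<rparr>"

lemma field_ring_simps [simp]:
  "carrier field_ring = UNIV" "x \<otimes>\<^bsub>field_ring\<^esub> y = x * y" "\<one>\<^bsub>field_ring\<^esub> = 1"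
  "x \<oplus>\<^bsub>field_ring\<^esub> y = x + y" "\<zero>\<^bsub>field_ring\<^esub> = 0"
  by (simp_all add: field_ring_def)

lemma field_field_ring: "field (field_ring :: 'a::field ring)"
proof -
  have "abelian_group (field_ring :: 'a ring)"
  proof (rule abelian_groupI)
    show "\<exists>y\<in>carrier field_ring. y \<oplus>\<^bsub>field_ring\<^esub> x = \<zero>\<^bsub>field_ring\<^esub>" for x :: 'a
      by (rule bexI[of _ "- x"]) simp_all
  qed (simp_all add: add.assoc add.commute)
  then have "cring (field_ring :: 'a ring)"
    by (rule cringI) (auto intro!: comm_monoidI simp: distrib_right)
  then interpret cring "field_ring :: 'a ring" .
  show ?thesis
  proof (rule cring_fieldI2)
    show "\<exists>b\<in>carrier field_ring. a \<otimes>\<^bsub>field_ring\<^esub> b = \<one>\<^bsub>field_ring\<^esub>"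
      if "a \<noteq> \<zero>\<^bsub>field_ring\<^esub>" for a :: 'a
      using that by (intro bexI[of _ "inverse a"]) simp_all
  qed simp
qed

lemma division_ring_iso_field:
  assumes "ring D" "field K" "D \<simeq> K"
  shows "division_ring D"
proof -
  interpret D: ring D by fact
  interpret K: field K by fact
  obtain h where h: "h \<in> ring_iso K D"
    using ring_iso_sym[OF D.ring_axioms assms(3)] by (auto simp: is_ring_iso_def)
  \<comment> \<open>The field structure transported along \<open>h\<close> has the image of zero as
    its zero, which has to be identified with the zero of \<open>D\<close>.\<close>
  then have "h \<zero>\<^bsub>K\<^esub> = \<zero>\<^bsub>D\<^esub>"
    by (intro ring_hom_zero[OF _ K.ring_axioms D.ring_axioms]) (simp add: ring_iso_def)
  then have "field D"
    using K.ring_iso_imp_img_field[OF h] by simp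
  then show ?thesis
    using field.field_Units[of D] D.ring_axioms by (simp add: division_ring_def)
qed


context quiver_algebra
begin

section \<open>The elements \<open>X\<^sub>M\<close>\<close>

text \<open>By \<open>X_gen_commute\<close> the fold behind \<open>finprod\<close> is left
  commutative on \<open>A\<close>, although \<open>B\<close> need not be commutative. Its insertion
  rule then holds, and inserting \<open>q\<close> prepends \<open>q\<close> to the word.\<close>

lemma finprod_independent:
  assumes "finite A" "A \<subseteq> V" "\<And>s t. \<lbrakk>s \<in> A; t \<in> A\<rbrakk> \<Longrightarrow> \<not> s \<rightarrow>\<^bsub>Q\<^esub> t"
  shows "\<exists>v. set v = A \<and> finprod B (X_gen Q) A = \<xi> v"
proof -
  define f where "f = mult B \<circ> X_gen Q"
  have f: "f q z = X_gen Q q \<otimes>\<^bsub>B\<^esub> z" for q z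
    by (simp add: f_def)
  interpret LCD A "carrier B" f
  proof
    fix s t z assume st: "s \<in> A" "t \<in> A" and z: "z \<in> carrier B"
    then have V: "s \<in> V" "t \<in> V" using assms(2) by auto
    show "f s (f t z) = f t (f s z)"
      using X_gen_commute[OF V assms(3)[OF st] assms(3)[OF st(2,1)]] V z
      by (simp add: f flip: B.m_assoc)
  qed (use assms(2) in \<open>auto simp: f\<close>)
  have "\<exists>v. set v = C \<and> foldD (carrier B) f \<one>\<^bsub>B\<^esub> C = \<xi> v" if "C \<subseteq> A" for C
    using finite_subset[OF that assms(1)] that
  proof (induction C)
    case empty
    show ?case by (intro exI[of _ "[]"]) (simp add: X_Nil)
  next
    case (insert q C)
    then have "C \<subseteq> A" by simp
    from insert.IH[OF this] obtain v
      where "set v = C" "foldD (carrier B) f \<one>\<^bsub>B\<^esub> C = \<xi> v" by blast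
    moreover from this have "foldD (carrier B) f \<one>\<^bsub>B\<^esub> (insert q C) = f q (\<xi> v)"
      using insert by (simp add: foldD_insert)
    then have "foldD (carrier B) f \<one>\<^bsub>B\<^esub> (insert q C) = \<xi> (q # v)"
      unfolding f X_Cons .
    ultimately show ?case
      by (intro exI[of _ "q # v"]) simp
  qed
  then show ?thesis
    using assms(1) by (simp add: finprod_def flip: f_def)
qed

section \<open>Exhausting a set of vertices by layers of sinks\<close>

definition layer_rest :: "'v set \<Rightarrow> nat \<Rightarrow> 'v set" where
  "layer_rest M j = M - (\<Union>i<j. sink_layer Q M i)"

lemma sink_layer_eq: "sink_layer Q M j = {q \<in> layer_rest M j. \<forall>t\<in>layer_rest M j. \<not> q \<rightarrow>\<^bsub>Q\<^esub> t}"
proof -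
  have "sink_layer Q M j = sinks (induce_subgraph Q (layer_rest M j))"
    by (subst sink_layer.simps) (simp add: layer_rest_def atLeast0LessThan)
  then show ?thesis
    unfolding sinks_induce_subgraph .
qed

lemma layer_rest_subset: "layer_rest M j \<subseteq> M"
  by (auto simp: layer_rest_def)

lemma sink_layer_subset: "sink_layer Q M j \<subseteq> M"
  using layer_rest_subset by (auto simp: sink_layer_eq)

lemma layer_rest_Suc: "layer_rest M (Suc j) = layer_rest M j - sink_layer Q M j"
  by (simp add: layer_rest_def lessThan_Suc Diff_Un Un_commute) blast

lemma layer_rest_antimono: "i \<le> j \<Longrightarrow> layer_rest M j \<subseteq> layer_rest M i"
  by (auto simp: layer_rest_def)

text \<open>A nonempty remainder has a sink by acyclicity, so the layers stop only once
  \<open>M\<close> is exhausted.\<close>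

lemma sink_layer_empty_iff:
  assumes "M \<subseteq> V"
  shows "sink_layer Q M j = {} \<longleftrightarrow> layer_rest M j = {}"
proof
  assume "sink_layer Q M j = {}"
  moreover have "layer_rest M j \<subseteq> V"
    using assms by (auto simp: layer_rest_def)
  ultimately show "layer_rest M j = {}"
    using exists_sink[OF fin_digraph acyclic, of "layer_rest M j"] unfolding sink_layer_eq by blast
qed (auto simp: sink_layer_eq)

lemma layer_rest_eventually_empty:
  assumes "M \<subseteq> V"
  shows "\<exists>j. layer_rest M j = {}"
proof -
  have fin: "finite (layer_rest M j)" for j
    using finite_subset[OF assms finite_V] by (simp add: layer_rest_def)
  \<comment> \<open>Each layer removes at least one vertex. The subtraction is truncated: at
    \<open>j = card M\<close> the bound is 0, which contradicts the assumption that no remainder is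
    empty.\<close>
  have "card (layer_rest M j) \<le> card M - j" if "\<And>j. layer_rest M j \<noteq> {}" for j
  proof (induction j)
    case 0
    show ?case by (simp add: layer_rest_def)
  next
    case (Suc j)
    have "sink_layer Q M j \<noteq> {}"
      using sink_layer_empty_iff[OF assms] that by blast
    moreover have "sink_layer Q M j \<subseteq> layer_rest M j"
      by (auto simp: sink_layer_eq)
    ultimately have "layer_rest M (Suc j) \<subset> layer_rest M j"
      unfolding layer_rest_Suc by blast
    then have "card (layer_rest M (Suc j)) < card (layer_rest M j)"
      by (rule psubset_card_mono[OF fin])
    with Suc show ?case by linarith
  qed
  then show ?thesis
    using fin by (metis card_0_eq diff_self_eq_0 le_zero_eq)
qed

lemma layer_prod_eq_X:
  assumes "M \<subseteq> V"
  shows "\<exists>v. set v = (\<Union>i\<le>m. sink_layer Q M i) \<and> layer_prod Q M m = \<xi> v"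
proof -
  have layer: "\<exists>v. set v = sink_layer Q M j \<and> finprod B (X_gen Q) (sink_layer Q M j) = \<xi> v" for j
  proof (rule finprod_independent)
    show "sink_layer Q M j \<subseteq> V"
      using sink_layer_subset assms by blast
    then show "finite (sink_layer Q M j)"
      using finite_V by (rule finite_subset)
  qed (auto simp: sink_layer_eq)
  show ?thesis
  proof (induction m)
    case 0
    show ?case using layer[of 0] by simp
  next
    case (Suc m)
    obtain u where u: "set u = (\<Union>i\<le>m. sink_layer Q M i)" "layer_prod Q M m = \<xi> u"
      using Suc by blast
    obtain v where v: "set v = sink_layer Q M (Suc m)" "finprod B (X_gen Q) (sink_layer Q M (Suc m)) = \<xi> v"
      using layer[of "Suc m"] by blast
    have "u \<in> lists V" "v \<in> lists V"
      using u(1) v(1) sink_layer_subset assms by (auto simp: in_lists_conv_set) blast+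
    then show ?case
      using u v by (intro exI[of _ "v @ u"]) (auto simp: X_append atMost_Suc)
  qed
qed

text \<open>All that the proof of the radical formula uses of this element: it is given by some word
  with the prescribed set of letters. The layers up to the last nonempty one exhaust
  \<open>M\<close>.\<close>

lemma X_set_eq_X:
  assumes M: "M \<subseteq> V"
  shows "\<exists>v. set v = M \<and> X_set Q M = \<xi> v"
proof (cases "M = {}")
  case True
  then show ?thesis
    by (simp add: X_set_def X_Nil)
next
  case False
  \<comment> \<open>The first index with empty remainder. It is positive as the remainder at 0 is
    \<open>M\<close>, and its predecessor is the index described by the \<open>THE\<close> in
    \<open>X_set\<close>.\<close>
  define n where "n = (LEAST j. layer_rest M j = {})"
  have n: "layer_rest M n = {}"
    unfolding n_def using layer_rest_eventually_empty[OF M] by (rule LeastI_ex)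
  have "n \<noteq> 0"
    using n False by (intro notI) (simp add: layer_rest_def)
  then obtain m where m: "n = Suc m"
    using not0_implies_Suc by blast
  have nonempty: "layer_rest M m \<noteq> {}"
    using not_less_Least[of m "\<lambda>j. layer_rest M j = {}"] m by (simp add: n_def)
  have "(THE m. sink_layer Q M m \<noteq> {} \<and> sink_layer Q M (Suc m) = {}) = m"
  proof (rule the_equality)
    show "sink_layer Q M m \<noteq> {} \<and> sink_layer Q M (Suc m) = {}"
      using n m nonempty by (simp add: sink_layer_empty_iff[OF M])
    show "i = m" if "sink_layer Q M i \<noteq> {} \<and> sink_layer Q M (Suc i) = {}" for i
    proof (rule ccontr)
      assume "i \<noteq> m"
      then consider "Suc i \<le> m" | "Suc m \<le> i" by linarith
      then show False
        using that nonempty n m layer_rest_antimono[of "Suc i" m M] layer_rest_antimono[of "Suc m" i M]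
        by cases (auto simp: sink_layer_empty_iff[OF M])
    qed
  qed
  then have X: "X_set Q M = (layer_prod Q M m :: ('v list \<Rightarrow>\<^sub>0 'k) set)"
    using False by (simp add: X_set_def)
  have "(\<Union>i\<le>m. sink_layer Q M i) = M"
    using n sink_layer_subset[of M] by (auto simp: layer_rest_def m lessThan_Suc_atMost)
  then show ?thesis
    using layer_prod_eq_X[OF M, of m] X by simp
qed

end


context quiver_algebra
begin

section \<open>The radical as a span\<close>

lemma ring_hom_scalar: "ring_hom_ring (field_ring :: 'k ring) B scalar"
proof (rule ring_hom_ringI)
  show "ring (field_ring :: 'k ring)"
    using field_field_ring field.is_ring by blast
qed (simp_all add: B.ring_axioms scalar_mult scalar_add scalar_1)

text \<open>The image of a field in a nonzero ring is a field; \<open>B\<close> is nonzero because a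
  character separates one from zero.\<close>

lemma subfield_scalars: "subfield (BQ_scalars Q :: ('v list \<Rightarrow>\<^sub>0 'k) set set) B"
proof -
  have "\<one>\<^bsub>B\<^esub> \<noteq> \<zero>\<^bsub>B\<^esub>"
    using \<chi>_one \<chi>_zero zero_neq_one by metis
  then have "subfield (scalar ` carrier field_ring) B"
    by (rule ring_hom_ring.img_is_subfield(2)[OF ring_hom_scalar field.carrier_is_subfield[OF field_field_ring]])
  then show ?thesis by (simp add: BQ_scalars_def)
qed

lemma scalar_in_scalars: "scalar c \<in> BQ_scalars Q"
  by (simp add: BQ_scalars_def)

text \<open>A Moebius inversion: the character of \<open>M\<close> is the sum, over all subsets of
  \<open>M\<close>, of the coefficient sums for that exact set of letters. By induction the proper
  subsets contribute zero, so the term for \<open>M\<close> vanishes too.\<close>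

lemma sum_over_content_eq_0:
  fixes f :: "'v list \<Rightarrow>\<^sub>0 'k"
  assumes "Poly_Mapping.keys f \<subseteq> lists V" "\<And>M. M \<subseteq> V \<Longrightarrow> E_eval M f = 0" "M \<subseteq> V"
  shows "(\<Sum>w | w \<in> Poly_Mapping.keys f \<and> set w = M. Poly_Mapping.lookup f w) = 0"
  using finite_subset[OF assms(3) finite_V] assms(3)
proof (induction M rule: finite_psubset_induct)
  case (psubset M)
  let ?g = "\<lambda>N. \<Sum>w | w \<in> Poly_Mapping.keys f \<and> set w = N. Poly_Mapping.lookup f w"
  let ?S = "{w \<in> Poly_Mapping.keys f. set w \<subseteq> M}"
  have "0 = E_eval M f"
    using assms(2) psubset.prems by simp
  also have "\<dots> = sum (Poly_Mapping.lookup f) ?S"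
    unfolding E_eval_eq by (intro sum.inter_filter[symmetric]) simp
  also have "\<dots> = (\<Sum>N\<in>Pow M. \<Sum>w | w \<in> ?S \<and> set w = N. Poly_Mapping.lookup f w)"
    by (rule sum.group[symmetric]) (use psubset.hyps in auto)
  also have "\<dots> = (\<Sum>N\<in>Pow M. ?g N)"
    by (intro sum.cong refl arg_cong[where f = "sum (Poly_Mapping.lookup f)"]) auto
  also have "\<dots> = ?g M + (\<Sum>N\<in>Pow M - {M}. ?g N)"
    using psubset.hyps by (intro sum.remove) auto
  also have "(\<Sum>N\<in>Pow M - {M}. ?g N) = 0"
  proof (rule sum.neutral, rule ballI)
    fix N assume "N \<in> Pow M - {M}"
    then have "N \<subset> M" by blast
    then show "?g N = 0"
      using psubset.prems by (intro psubset.IH) auto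
  qed
  finally show ?case by simp
qed

lemma radical_eq_span:
  "radical B = linear_span (BQ_scalars Q) B
    {X_set Q (set w) \<ominus>\<^bsub>B\<^esub> X_word Q w | w. w \<in> lists V}"
  (is "_ = linear_span _ _ ?D")
proof
  \<comment> \<open>A fixed word for each set of letters, so that the computation can be lifted to
    the free algebra.\<close>
  obtain v where v: "\<And>M. M \<subseteq> V \<Longrightarrow> set (v M) = M" "\<And>M. M \<subseteq> V \<Longrightarrow> X_set Q M = \<xi> (v M)"
    using X_set_eq_X by metis
  have vl: "v (set w) \<in> lists V" and vs: "set (v (set w)) = set w"
    and vX: "X_set Q (set w) = \<xi> (v (set w))" if "w \<in> lists V" for w
    using v[of "set w"] that by (auto simp: in_lists_conv_set)
  have D: "?D \<subseteq> carrier B"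
  proof
    fix d assume "d \<in> ?D"
    then obtain w where w: "w \<in> lists V" and d: "d = X_set Q (set w) \<ominus>\<^bsub>B\<^esub> \<xi> w" by blast
    show "d \<in> carrier B"
      unfolding d vX[OF w] by (intro B.minus_closed X_closed vl w)
  qed
  note span = B.linear_span_zero B.linear_span_add[OF subfield_scalars D]
    B.linear_span_smult[OF subfield_scalars D scalar_in_scalars]
  show "linear_span (BQ_scalars Q) B ?D \<subseteq> radical B"
  proof (rule B.linear_span_subset)
    show "?D \<subseteq> radical B"
    proof
      fix d assume "d \<in> ?D"
      then obtain w where w: "w \<in> lists V" "d = X_set Q (set w) \<ominus>\<^bsub>B\<^esub> \<xi> w" by blast
      have "\<chi> M d = 0" for M
        unfolding w(2) vX[OF w(1)] using w(1) vl[OF w(1)]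
        by (simp only: \<chi>_diff X_closed \<chi>_X vs) simp
      then show "d \<in> radical B"
        using D \<open>d \<in> ?D\<close> by (auto simp: radical_eq)
    qed
  qed (auto simp: radical_eq BQ_scalars_def)
  show "radical B \<subseteq> linear_span (BQ_scalars Q) B ?D"
  proof
    fix b assume b: "b \<in> radical B"
    then obtain f where f: "Poly_Mapping.keys f \<subseteq> lists V" "b = \<pi> f"
      by (auto simp: radical_eq elim: carrier_BE)
    have E: "E_eval M f = 0" if "M \<subseteq> V" for M
      using b that by (auto simp: radical_eq f(2) \<chi>_\<pi>[OF f(1)])
    let ?c = "Poly_Mapping.lookup f"
    let ?s = "\<lambda>w. Poly_Mapping.single w (?c w) - Poly_Mapping.single (v (set w)) (?c w)"
    \<comment> \<open>Each \<open>?s w\<close> maps to a scalar multiple, with factor minus the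
      coefficient, of a generator of the span. The support is tracked because the quotient map is
      additive on polynomials over \<open>V\<close>.\<close>
    have span_sum: "\<pi> (\<Sum>w\<in>W. ?s w) \<in> linear_span (BQ_scalars Q) B ?D \<and>
        Poly_Mapping.keys (\<Sum>w\<in>W. ?s w) \<subseteq> lists V"
      if "finite W" "W \<subseteq> lists V" for W
      using that
    proof (induction W)
      case empty
      show ?case using span(1) by simp
    next
      case (insert w W)
      then have w: "w \<in> lists V" "v (set w) \<in> lists V"
        using vl by auto
      have keys: "Poly_Mapping.keys (?s w) \<subseteq> lists V"
        by (rule keys_diff_subset) (use w in auto)
      have "?s w = Poly_Mapping.single [] (- ?c w) * (word_poly (v (set w)) - word_poly w)"
        by (simp add: right_diff_distrib mult_single plus_list_def single_uminus)
      also have "\<pi> \<dots> = scalar (- ?c w) \<otimes>\<^bsub>B\<^esub> \<pi> (word_poly (v (set w)) - word_poly w)"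
        by (intro \<pi>_mult keys_diff_subset) (use w in auto)
      also have "\<pi> (word_poly (v (set w)) - word_poly w) = X_set Q (set w) \<ominus>\<^bsub>B\<^esub> \<xi> w"
        using w \<pi>_diff[of "word_poly (v (set w))" "word_poly w"] by (simp add: vX X_word_eq)
      finally have "\<pi> (?s w) \<in> linear_span (BQ_scalars Q) B ?D"
        using span(3)[OF B.linear_span_base[OF subfield_scalars D]] w(1) by auto
      then show ?case
        using insert keys span(2) by (simp add: \<pi>_add keys_add_subset)
    qed
    \<comment> \<open>The coefficient at \<open>u\<close> collects all words with the letters of
      \<open>u\<close> if \<open>u\<close> is a chosen representative, giving a sum that vanishes;
      for any other \<open>u\<close> nothing is collected. Hence the \<open>?s w\<close> add up to
      \<open>f\<close> itself.\<close>
    have "(\<Sum>w\<in>Poly_Mapping.keys f. Poly_Mapping.single (v (set w)) (?c w)) = 0"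
    proof (rule poly_mapping_eqI)
      fix u
      have "(\<Sum>w\<in>Poly_Mapping.keys f. if v (set w) = u then ?c w else 0) = 0"
      proof (cases "set u \<subseteq> V \<and> v (set u) = u")
        case True
        have "(\<Sum>w\<in>Poly_Mapping.keys f. if v (set w) = u then ?c w else 0) =
            (\<Sum>w\<in>Poly_Mapping.keys f. if set w = set u then ?c w else 0)"
        proof (intro sum.cong refl)
          fix w assume "w \<in> Poly_Mapping.keys f"
          then have "w \<in> lists V" using f(1) by blast
          then have "v (set w) = u \<longleftrightarrow> set w = set u"
            using vs[of w] True by metis
          then show "(if v (set w) = u then ?c w else 0) = (if set w = set u then ?c w else 0)"
            by simp
        qed
        also have "\<dots> = (\<Sum>w | w \<in> Poly_Mapping.keys f \<and> set w = set u. ?c w)"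
          by (intro sum.inter_filter[symmetric]) simp
        also have "\<dots> = 0"
          using True by (intro sum_over_content_eq_0 f(1) E) auto
        finally show ?thesis .
      next
        case False
        have "v (set w) \<noteq> u" if "w \<in> Poly_Mapping.keys f" for w
        proof
          assume u: "v (set w) = u"
          have "w \<in> lists V" using f(1) that by blast
          with vs[of w] u False show False by (auto simp: in_lists_conv_set)
        qed
        then show ?thesis by simp
      qed
      then show "Poly_Mapping.lookup (\<Sum>w\<in>Poly_Mapping.keys f. Poly_Mapping.single (v (set w)) (?c w)) u
          = Poly_Mapping.lookup 0 u"
        by (simp add: lookup_sum lookup_single when_def)
    qed
    then have "(\<Sum>w\<in>Poly_Mapping.keys f. ?s w) = f"
      by (simp add: sum_subtractf poly_mapping_sum_single)
    then show "b \<in> linear_span (BQ_scalars Q) B ?D"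
      using span_sum[OF finite_keys f(1)] by (simp add: f(2))
  qed
qed


section \<open>Finite dimension\<close>

text \<open>Let \<open>s\<close> be a sink among the letters of \<open>U\<close>. Every word over
  \<open>U\<close> has the same value as one containing \<open>s\<close> at most once: building it
  from the right, a newly prepended \<open>s\<close> is absorbed by \<open>X_sink\<close> if an
  \<open>s\<close> is already present. The parts around \<open>s\<close> use fewer letters, so they
  take finitely many values.\<close>

lemma finite_X:
  assumes "U \<subseteq> V"
  shows "finite (\<xi> ` lists U)"
  using finite_subset[OF assms finite_V] assms
proof (induction U rule: finite_psubset_induct)
  case (psubset U)
  show ?case
  proof (cases "U = {}")
    case True
    then show ?thesis by simp
  next
    case False
    then obtain s where s: "s \<in> U" "\<And>t. t \<in> U \<Longrightarrow> \<not> s \<rightarrow>\<^bsub>Q\<^esub> t"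
      using exists_sink[OF fin_digraph acyclic psubset.prems] by blast
    let ?U = "lists (U - {s})"
    let ?A = "\<xi> ` ?U"
    have fin: "finite ?A"
      using psubset.IH[of "U - {s}"] s(1) psubset.prems by blast
    have split: "(\<exists>u\<in>?U. \<xi> w = \<xi> u) \<or> (\<exists>u\<in>?U. \<exists>v\<in>?U. \<xi> w = \<xi> (u @ [s] @ v))"
      if "w \<in> lists U" for w
      using that
    proof (induction w)
      case Nil
      show ?case by (intro disjI1 bexI[of _ "[]"]) simp_all
    next
      case (Cons q w)
      then have q: "q \<in> U" by simp
      from Cons consider u where "u \<in> ?U" "\<xi> w = \<xi> u"
        | u v where "u \<in> ?U" "v \<in> ?U" "\<xi> w = \<xi> (u @ [s] @ v)" by blast
      then show ?case
      proof cases
        case 1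
        show ?thesis
        proof (cases "q = s")
          case True
          have "\<xi> (q # w) = \<xi> ([] @ [s] @ u)"
            using 1 True by (simp add: X_Cons)
          then show ?thesis using 1(1) by blast
        next
          case False
          have "\<xi> (q # w) = \<xi> (q # u)" "q # u \<in> ?U"
            using 1 False q by (auto simp: X_Cons)
          then show ?thesis by blast
        qed
      next
        case 2
        have uv: "u \<in> lists V" "v \<in> lists V" "s \<in> V"
          using 2(1,2) s(1) psubset.prems by auto
        show ?thesis
        proof (cases "q = s")
          case True
          have "\<xi> (q # w) = \<xi> ((s # u @ [s]) @ v)"
            using 2 True by (simp add: X_Cons)
          also have "\<dots> = \<xi> (s # u @ [s]) \<otimes>\<^bsub>B\<^esub> \<xi> v"
            using uv by (intro X_append) auto
          also have "\<xi> (s # u @ [s]) = \<xi> (u @ [s])"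
            using uv s(2) 2(1) by (intro X_sink) auto
          also have "\<xi> (u @ [s]) \<otimes>\<^bsub>B\<^esub> \<xi> v = \<xi> ((u @ [s]) @ v)"
            using uv by (intro X_append[symmetric]) auto
          finally show ?thesis using 2(1,2) by auto
        next
          case False
          have "\<xi> (q # w) = \<xi> ((q # u) @ [s] @ v)" "q # u \<in> ?U"
            using 2 False q by (auto simp: X_Cons)
          then show ?thesis using 2(2) by blast
        qed
      qed
    qed
    have "\<xi> ` lists U \<subseteq> ?A \<union> (\<lambda>(a, b). a \<otimes>\<^bsub>B\<^esub> (X_gen Q s \<otimes>\<^bsub>B\<^esub> b)) ` (?A \<times> ?A)"
    proof
      fix a assume "a \<in> \<xi> ` lists U"
      then obtain w where w: "w \<in> lists U" "a = \<xi> w" by blast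
      from split[OF w(1)] show "a \<in> ?A \<union> (\<lambda>(a, b). a \<otimes>\<^bsub>B\<^esub> (X_gen Q s \<otimes>\<^bsub>B\<^esub> b)) ` (?A \<times> ?A)"
      proof
        assume "\<exists>u\<in>?U. \<xi> w = \<xi> u"
        then show ?thesis using w(2) by blast
      next
        assume "\<exists>u\<in>?U. \<exists>v\<in>?U. \<xi> w = \<xi> (u @ [s] @ v)"
        then obtain u v where uv: "u \<in> ?U" "v \<in> ?U" "\<xi> w = \<xi> (u @ [s] @ v)" by blast
        have "u \<in> lists V" "[s] @ v \<in> lists V"
          using uv(1,2) s(1) psubset.prems by auto
        then have "a = \<xi> u \<otimes>\<^bsub>B\<^esub> (X_gen Q s \<otimes>\<^bsub>B\<^esub> \<xi> v)"
          using w(2) uv(3) X_append[of u "[s] @ v"] by (simp add: X_Cons)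
        then show ?thesis
          using uv(1,2) by (intro UnI2 image_eqI[of _ _ "(\<xi> u, \<xi> v)"]) auto
      qed
    qed
    then show ?thesis
      by (rule finite_subset) (use fin in simp)
  qed
qed

lemma finite_dimension_B: "ring.finite_dimension B (BQ_scalars Q) (carrier B)"
proof -
  obtain Us where Us: "set Us = \<xi> ` lists V"
    using finite_list[OF finite_X[OF subset_refl]] by blast
  have carr: "set Us \<subseteq> carrier B"
    unfolding Us by (rule image_subsetI) (rule X_closed)
  note span = B.Span_subgroup_props[OF subfield_scalars carr]
  have "b \<in> B.Span (BQ_scalars Q) Us" if "b \<in> carrier B" for b
    using that
  proof (induction rule: B_induct)
    case (smult w c)
    then have "\<xi> w \<in> B.Span (BQ_scalars Q) Us"
      using B.Span_base_incl[OF subfield_scalars carr] Us by blast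
    then show ?case
      by (rule B.Span_smult_closed[OF subfield_scalars carr scalar_in_scalars])
  qed (rule span(3))
  then have "B.Span (BQ_scalars Q) Us = carrier B"
    using span(1) by blast
  then show ?thesis
    using B.Span_finite_dimension[OF subfield_scalars carr] by (simp only:)
qed


section \<open>Basicness\<close>

lemma ring_hom_\<chi>: "ring_hom_ring B (field_ring :: 'k ring) (\<chi> M)"
proof (rule ring_hom_ringI)
  show "ring (field_ring :: 'k ring)"
    using field_field_ring field.is_ring by blast
qed (simp_all add: B.ring_axioms)

lemma kernel_\<chi>: "a_kernel B (field_ring :: 'k ring) (\<chi> M) = {b \<in> carrier B. \<chi> M b = 0}"
  by (simp add: a_kernel_def')

lemma ideal_kernel_\<chi>: "ideal {b \<in> carrier B. \<chi> M b = 0} B"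
  using ring_hom_ring.kernel_is_ideal[OF ring_hom_\<chi>] by (simp only: kernel_\<chi>)

lemma division_ring_Quot_kernel: "division_ring (B Quot {b \<in> carrier B. \<chi> M b = 0})"
proof (rule division_ring_iso_field)
  show "ring (B Quot {b \<in> carrier B. \<chi> M b = 0})"
    by (rule ideal.quotient_is_ring[OF ideal_kernel_\<chi>])
  have "c \<in> \<chi> M ` carrier B" for c
    using \<chi>_scalar[of M c] scalar_closed by (rule image_eqI[OF sym])
  then have "\<chi> M ` carrier B = carrier field_ring" by auto
  from ring_hom_ring.FactRing_iso[OF ring_hom_\<chi> this]
  show "B Quot {b \<in> carrier B. \<chi> M b = 0} \<simeq> (field_ring :: 'k ring)"
    by (simp only: kernel_\<chi>)
qed (rule field_field_ring)

section \<open>Separating the characters and splitting the quotient by the radical\<close>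

lemma exists_content_indicator:
  assumes "M \<subseteq> V"
  shows "\<exists>e\<in>carrier B. \<forall>N\<subseteq>V. \<chi> N e = (if N = M then 1 else 0)"
proof -
  \<comment> \<open>Induction over the letters tested so far: for \<open>U\<close>, the element
    detects only whether \<open>N\<close> and \<open>M\<close> agree on \<open>U\<close>.\<close>
  have "\<exists>e\<in>carrier B. \<forall>N\<subseteq>V. \<chi> N e = (if N \<inter> U = M \<inter> U then 1 else 0)" if "U \<subseteq> V" for U
    using finite_subset[OF that finite_V] that
  proof (induction U)
    case empty
    show ?case by (intro bexI[of _ "\<one>\<^bsub>B\<^esub>"]) simp_all
  next
    case (insert q U)
    then obtain e where e: "e \<in> carrier B" "\<And>N. N \<subseteq> V \<Longrightarrow> \<chi> N e = (if N \<inter> U = M \<inter> U then 1 else 0)"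
      by auto
    define x where "x = (if q \<in> M then X_gen Q q else \<one>\<^bsub>B\<^esub> \<ominus>\<^bsub>B\<^esub> X_gen Q q)"
    have q: "q \<in> V" using insert.prems by simp
    have x: "x \<in> carrier B" "\<And>N. \<chi> N x = (if q \<in> N \<longleftrightarrow> q \<in> M then 1 else 0)"
      using q by (auto simp: x_def)
    have "N \<inter> insert q U = M \<inter> insert q U \<longleftrightarrow> (q \<in> N \<longleftrightarrow> q \<in> M) \<and> N \<inter> U = M \<inter> U" for N
      using insert.hyps(2) by auto
    then show ?case
      using x e by (intro bexI[of _ "x \<otimes>\<^bsub>B\<^esub> e"]) simp_all
  qed
  from this[OF subset_refl] obtain e
    where "e \<in> carrier B" "\<And>N. N \<subseteq> V \<Longrightarrow> \<chi> N e = (if N \<inter> V = M \<inter> V then 1 else 0)" by blast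
  moreover have "N \<inter> V = M \<inter> V \<longleftrightarrow> N = M" if "N \<subseteq> V" for N
    using that assms by blast
  ultimately show ?thesis by (intro bexI[of _ e]) simp_all
qed

text \<open>Lagrange interpolation: the indicator elements, weighted by the prescribed values, are
  summed over the finitely many subsets of \<open>V\<close>. This yields surjectivity onto the
  product of quotients below.\<close>

lemma exists_interpolation: "\<exists>b\<in>carrier B. \<forall>M\<subseteq>V. \<chi> M b = c M"
proof -
  have "\<exists>b\<in>carrier B. \<forall>M\<subseteq>V. \<chi> M b = (if M \<in> \<M> then c M else 0)" if "finite \<M>" "\<M> \<subseteq> Pow V" for \<M>
    using that
  proof (induction \<M>)
    case empty
    show ?case by (intro bexI[of _ "\<zero>\<^bsub>B\<^esub>"]) simp_all
  next
    case (insert M \<M>)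
    then obtain b where b: "b \<in> carrier B" "\<And>N. N \<subseteq> V \<Longrightarrow> \<chi> N b = (if N \<in> \<M> then c N else 0)"
      by auto
    obtain e where e: "e \<in> carrier B" "\<And>N. N \<subseteq> V \<Longrightarrow> \<chi> N e = (if N = M then 1 else 0)"
      using exists_content_indicator[of M] insert.prems by auto
    show ?case
      using b e insert.hyps(2)
      by (intro bexI[of _ "(scalar (c M) \<otimes>\<^bsub>B\<^esub> e) \<oplus>\<^bsub>B\<^esub> b"]) auto
  qed
  from this[of "Pow V"] show ?thesis
    using finite_V by simp
qed

text \<open>The projections to the quotients by the character kernels combine into a homomorphism to
  their product. Its kernel is the radical and interpolation makes it surjective, so the first
  isomorphism theorem applies; each factor is a copy of the field.\<close>

lemma basic_B: "basic_algebra (BQ_scalars Q) B"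
proof -
  obtain Ms where Ms: "set Ms = Pow V" "distinct Ms"
    using finite_distinct_list[of "Pow V"] finite_V by auto
  \<comment> \<open>The family of ideals in \<open>canonical_proj_ext I n\<close> runs over the
    indices 0 to \<open>n\<close> inclusive. The list is nonempty because the empty set is a subset
    of \<open>V\<close>.\<close>
  define n where "n = length Ms - 1"
  have len: "length Ms = Suc n"
    using Ms(1) by (cases Ms) (auto simp: n_def)
  define I where "I i = {b \<in> carrier B. \<chi> (Ms ! i) b = 0}" for i
  have MsV: "Ms ! i \<subseteq> V" if "i \<le> n" for i
    using nth_mem[of i Ms] that Ms(1) len by auto
  have ideal: "ideal (I i) B" for i
    unfolding I_def by (rule ideal_kernel_\<chi>)
  let ?Ds = "map (\<lambda>i. B Quot I i) [0..<Suc n]"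
  let ?h = "B.canonical_proj_ext I n"
  have hom: "ring_hom_ring B (RDirProd_list ?Ds) ?h"
    by (rule B.canonical_proj_ext_ring_hom[OF ideal])
  have "radical B = (\<Inter>i\<le>n. I i)"
  proof (intro equalityI subsetI)
    fix b assume "b \<in> radical B"
    then show "b \<in> (\<Inter>i\<le>n. I i)"
      using MsV by (simp add: radical_eq I_def)
  next
    fix b assume b: "b \<in> (\<Inter>i\<le>n. I i)"
    have "\<chi> M b = 0" if "M \<subseteq> V" for M
    proof -
      obtain i where "i < length Ms" "M = Ms ! i"
        using \<open>M \<subseteq> V\<close> Ms(1) by (metis PowI in_set_conv_nth)
      then show ?thesis
        using b len by (auto simp: I_def)
    qed
    moreover have "b \<in> carrier B"
      using b by (auto simp: I_def)
    ultimately show "b \<in> radical B"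
      by (simp add: radical_eq)
  qed
  then have ker: "a_kernel B (RDirProd_list ?Ds) ?h = radical B"
    using B.canonical_proj_ext_ker[of n I, OF ideal] by (simp only:)
  have "?h ` carrier B = carrier (RDirProd_list ?Ds)"
  proof (intro equalityI subsetI)
    fix y assume "y \<in> ?h ` carrier B"
    then show "y \<in> carrier (RDirProd_list ?Ds)"
      using ring_hom_closed[OF ring_hom_ring.homh[OF hom]] by blast
  next
    fix y assume y: "y \<in> carrier (RDirProd_list ?Ds)"
    have leny: "length y = Suc n"
      using RDirProd_list_carrier_mem(1)[OF y] by simp
    have "\<exists>b\<in>carrier B. y ! i = I i +>\<^bsub>B\<^esub> b" if "i \<le> n" for i
    proof -
      have "i < length ?Ds" using that by simp
      from RDirProd_list_carrier_mem(2)[OF y this] have "y ! i \<in> carrier (B Quot I i)"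
        using that by (simp del: upt_Suc)
      then show ?thesis
        by (auto simp: FactRing_def A_RCOSETS_def')
    qed
    then obtain b where b: "\<And>i. i \<le> n \<Longrightarrow> b i \<in> carrier B" "\<And>i. i \<le> n \<Longrightarrow> y ! i = I i +>\<^bsub>B\<^esub> b i"
      by metis
    \<comment> \<open>The position of \<open>M\<close> in the duplicate-free list, which turns the
      family of representatives \<open>b\<close> into prescribed values indexed by subsets.\<close>
    define ix where "ix M = (THE i. i \<le> n \<and> Ms ! i = M)" for M
    have ix: "ix (Ms ! i) = i" if "i \<le> n" for i
      unfolding ix_def using that Ms(2) len by (intro the_equality) (auto simp: nth_eq_iff_index_eq)
    obtain a where a: "a \<in> carrier B" "\<And>M. M \<subseteq> V \<Longrightarrow> \<chi> M a = \<chi> M (b (ix M))"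
      using exists_interpolation[of "\<lambda>M. \<chi> M (b (ix M))"] by blast
    have "y ! i = I i +>\<^bsub>B\<^esub> a" if "i \<le> n" for i
    proof -
      have "\<chi> (Ms ! i) a = \<chi> (Ms ! i) (b i)"
        using a(2)[OF MsV[OF that]] by (simp only: ix[OF that])
      then have "a \<ominus>\<^bsub>B\<^esub> b i \<in> I i"
        using a(1) b(1)[OF that] by (simp add: I_def)
      then have "I i +>\<^bsub>B\<^esub> a = I i +>\<^bsub>B\<^esub> b i"
        using B.quotient_eq_iff_same_a_r_cos[OF ideal a(1) b(1)[OF that]] by blast
      then show ?thesis
        using b(2)[OF that] by simp
    qed
    then have "y = ?h a"
      by (intro nth_equalityI) (simp_all add: leny B.canonical_proj_ext_def del: upt_Suc)
    then show "y \<in> ?h ` carrier B"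
      using a(1) by blast
  qed
  from ring_hom_ring.FactRing_iso[OF hom this]
  have "B Quot radical B \<simeq> RDirProd_list ?Ds"
    by (simp only: ker)
  moreover have "\<forall>D\<in>set ?Ds. division_ring D"
    using division_ring_Quot_kernel by (auto simp: I_def)
  ultimately show ?thesis
    unfolding basic_algebra_def using finite_dimension_B by blast
qed

end

theorem proposition4p1:
  fixes Q :: "('v, 'e) pre_digraph"
  assumes "fin_digraph Q" and "acyclic_quiver Q"
  shows "radical (BQ Q :: ('v list \<Rightarrow>\<^sub>0 'k::field) set ring) =
           linear_span (BQ_scalars Q) (BQ Q)
             {X_set Q (set w) \<ominus>\<^bsub>BQ Q\<^esub> X_word Q w | w. w \<in> lists (verts Q)} \<and>
         basic_algebra (BQ_scalars Q) (BQ Q :: ('v list \<Rightarrow>\<^sub>0 'k) set ring) \<and>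
         (\<forall>M \<subseteq> verts Q.
           simple_left_module (BQ Q) (E_module M :: (('v list \<Rightarrow>\<^sub>0 'k) set, 'k) module)) \<and>
         (\<forall>M \<subseteq> verts Q. \<forall>N \<subseteq> verts Q.
           isomorphic_modules (BQ Q) (E_module M :: (('v list \<Rightarrow>\<^sub>0 'k) set, 'k) module) (E_module N)
             \<longrightarrow> M = N) \<and>
         (\<forall>S :: (('v list \<Rightarrow>\<^sub>0 'k) set, 'n) module. simple_left_module (BQ Q) S \<longrightarrow>
           (\<exists>M \<subseteq> verts Q. isomorphic_modules (BQ Q) S (E_module M)))"
proof -
  interpret quiver_algebra Q "TYPE('k)"
    by (rule quiver_algebra.intro[OF assms])
  show ?thesis
  proof (intro conjI allI impI)
    show "radical B = linear_span (BQ_scalars Q) B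
        {X_set Q (set w) \<ominus>\<^bsub>B\<^esub> X_word Q w | w. w \<in> lists (verts Q)}"
      by (rule radical_eq_span)
    show "basic_algebra (BQ_scalars Q) B"
      by (rule basic_B)
    show "simple_left_module B (EM M)" for M
      by (rule simple_E_module)
    show "M = N" if "M \<subseteq> V" "N \<subseteq> V" "isomorphic_modules B (EM M) (EM N)" for M N
      using that by (rule E_module_inject)
    show "\<exists>M\<subseteq>V. isomorphic_modules B S (EM M)"
      if "simple_left_module B S" for S :: "(('v list \<Rightarrow>\<^sub>0 'k) set, 'n) module"
      by (rule simple_left_module_iso_E_module[OF that]) (intro exI conjI)
  qed
qed

end
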